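(* (First fundamental theorem of coinvariant theory for $SL_{\infty,0}(k)$.) The subring of $k[SL_{\infty,0}]$-coinvariants of $k[M_\infty]$ under the coaction $\rho_\infty$ is $$k[M_\infty]^{k[SL_{\infty,0}]}=\widehat{k[\delta_\infty]} .$$
   Context: $k$ is an algebraically closed field of characteristic $0$; $m,n$ are positive integers. $k[b_{i,j}]_{m,n}$ is the polynomial ring in variables $b_{ij}$, $-m\le i\le n-1$, $-m\le j\le-1$. For $m'\ge m$, $n'\ge n$, $E_{(m',n',m,n)}:k[b_{i,j}]_{m',n'}\to k[b_{i,j}]_{m,n}$ sends $b_{ij}$ to $b_{ij}$ if $-m\le i\le n-1$, $-m\le j\le-1$; to $1$ if $-m'\le i=j\le-m-1$; to $0$ otherwise. $k[M_\infty]=\varprojlim k[b_{i,j}]_{m,n}$. $k[\delta_{m,n}]\subset k[b_{i,j}]_{m,n}$ is the $k$-subalgebra generated by the $m\times m$ determinants $d_{l_0\dots l_{m-1}}$ with rows $-m\le l_0<\dots<l_{m-1}\le n-1$ and columns $-m,\dots,-1$. $E_{(m',n',m,n)}$ restricts to $e_{(m',n',m,n)}:k[\delta_{m',n'}]\to k[\delta_{m,n}]$, sending $d_{-m',\dots,-m-1,l_0,\dots,l_{m-1}}$ (with $-m\le l_0<\dots<l_{m-1}\le n-1$) to $d_{l_0\dots l_{m-1}}$ and the other generators to $0$. $\widehat{k[\delta_\infty]}=\varprojlim k[\delta_{m,n}]\subset k[M_\infty]$. $SL_{m,0}(k)$ is the group of $m\times m$ matrices of determinant $1$ with indices from $-m$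 to $-1$, with coordinate ring $k[SL_{m,0}]$ generated by $g_{ij}$; for $m'\ge m$, $k[SL_{m',0}]\to k[SL_{m,0}]$ sends $g_{ij}$ to $g_{ij}$ if $i,j\ge-m$ and to $\delta_{ij}$ otherwise; $k[SL_{\infty,0}]=\varprojlim k[SL_{m,0}]$. Let $\rho_{(m,n)}:k[b_{i,j}]_{m,n}\to k[b_{i,j}]_{m,n}\otimes k[SL_{m,0}]$ be the algebra homomorphism $b_{ij}\mapsto\sum_{k=-m}^{-1}b_{ik}\otimes g_{kj}$. The coaction $\rho_\infty:k[M_\infty]\to k[M_\infty]\hat\otimes k[SL_{\infty,0}]:=\varprojlim k[b_{i,j}]_{m,n}\otimes k[SL_{m,0}]$ is $\{x_{(m,n)}\}\mapsto\{\rho_{(m,n)}(x_{(m,n)})\}$. An element $x\in k[M_\infty]$ is coinvariant if $\rho_\infty(x)=x\otimes1$. *)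

theory Defs
  imports
    "HOL-Library.Poly_Mapping"
    "HOL-Library.FuncSet"
    "HOL-Algebra.Generated_Rings"
    "HOL-Algebra.QuotRing"
    "HOL-Algebra.Module"
    "Jordan_Normal_Form.Determinant"
begin

section \<open>Commutative algebras over a field\<close>

text \<open>
  The ground field is a type \<open>'k\<close>; a \<open>'k\<close>-algebra with carrier in \<open>'a\<close> is a record of type
  \<open>('k, 'a) module\<close> (a HOL-Algebra ring together with a scalar multiplication).
\<close>

subsection \<open>Polynomials\<close>

text \<open>A monomial is a finitely supported exponent function on the variables.\<close>

type_synonym ('v, 'k) mpol = "('v \<Rightarrow>\<^sub>0 nat) \<Rightarrow>\<^sub>0 'k"

definition mvar :: "'v \<Rightarrow> ('v, 'k::comm_ring_1) mpol" where
  "mvar v = Poly_Mapping.single (Poly_Mapping.single v 1) 1"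

definition poly_alg :: "'v set \<Rightarrow> ('k::comm_ring_1, ('v, 'k) mpol) module" where
  "poly_alg V = \<lparr>carrier = {p. \<forall>t\<in>Poly_Mapping.keys p. Poly_Mapping.keys t \<subseteq> V},
     monoid.mult = (*), one = 1, zero = 0, add = (+),
     module.smult = (\<lambda>c p. Poly_Mapping.single 0 c * p)\<rparr>"

text \<open>The homomorphism of \<open>'k\<close>-algebras from a polynomial ring to \<open>A\<close> that sends each variable
  \<open>v\<close> to \<open>\<phi> v\<close>.\<close>

definition alg_eval ::
    "('k::zero, 'a) module \<Rightarrow> ('v \<Rightarrow> 'a) \<Rightarrow> ('v, 'k) mpol \<Rightarrow> 'a" where
  "alg_eval A \<phi> p =
     (\<Oplus>\<^bsub>A\<^esub>t\<in>Poly_Mapping.keys p. Poly_Mapping.lookup p t \<odot>\<^bsub>A\<^esub>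
        (\<Otimes>\<^bsub>A\<^esub>v\<in>Poly_Mapping.keys t. \<phi> v [^]\<^bsub>A\<^esub> Poly_Mapping.lookup t v))"

subsection \<open>Generated subalgebras, quotients and tensor products\<close>

definition gen_subalg :: "('k, 'a) module \<Rightarrow> 'a set \<Rightarrow> ('k, 'a) module" where
  "gen_subalg A S = A\<lparr>carrier := generate_ring A ({c \<odot>\<^bsub>A\<^esub> \<one>\<^bsub>A\<^esub> |c. True} \<union> S)\<rparr>"

definition quot_alg :: "('k, 'a) module \<Rightarrow> 'a set \<Rightarrow> ('k, 'a set) module" where
  "quot_alg A I = ring.extend (A Quot I)
     (module.fields (\<lambda>c X. \<Union>x\<in>X. I +>\<^bsub>A\<^esub> (c \<odot>\<^bsub>A\<^esub> x)))"

text \<open>The free module on the set of pairs \<open>(a, b)\<close>, with \<open>(a, b) (a', b') = (a a', b b')\<close>.\<close>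

definition free_pair_alg ::
    "('k::comm_ring_1, 'a) module \<Rightarrow> ('k, 'b) module \<Rightarrow> ('k, ('a \<times> 'b) \<Rightarrow>\<^sub>0 'k) module" where
  "free_pair_alg A B =
     \<lparr>carrier = {p. Poly_Mapping.keys p \<subseteq> carrier A \<times> carrier B},
      monoid.mult = (\<lambda>p q. \<Sum>x\<in>Poly_Mapping.keys p. \<Sum>y\<in>Poly_Mapping.keys q.
                Poly_Mapping.single (fst x \<otimes>\<^bsub>A\<^esub> fst y, snd x \<otimes>\<^bsub>B\<^esub> snd y)
                  (Poly_Mapping.lookup p x * Poly_Mapping.lookup q y)),
      one = Poly_Mapping.single (\<one>\<^bsub>A\<^esub>, \<one>\<^bsub>B\<^esub>) 1,
      zero = 0, add = (+),
      module.smult = (\<lambda>c. Poly_Mapping.map ((*) c))\<rparr>"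

definition bilinear_rels ::
    "('k::comm_ring_1, 'a) module \<Rightarrow> ('k, 'b) module \<Rightarrow> (('a \<times> 'b) \<Rightarrow>\<^sub>0 'k) set" where
  "bilinear_rels A B =
     {Poly_Mapping.single (a \<oplus>\<^bsub>A\<^esub> a', b) 1 - Poly_Mapping.single (a, b) 1
        - Poly_Mapping.single (a', b) 1
        |a a' b. a \<in> carrier A \<and> a' \<in> carrier A \<and> b \<in> carrier B} \<union>
     {Poly_Mapping.single (a, b \<oplus>\<^bsub>B\<^esub> b') 1 - Poly_Mapping.single (a, b) 1
        - Poly_Mapping.single (a, b') 1
        |a b b'. a \<in> carrier A \<and> b \<in> carrier B \<and> b' \<in> carrier B} \<union>
     {Poly_Mapping.single (c \<odot>\<^bsub>A\<^esub> a, b) 1 - Poly_Mapping.single (a, b) c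
        |c a b. a \<in> carrier A \<and> b \<in> carrier B} \<union>
     {Poly_Mapping.single (a, c \<odot>\<^bsub>B\<^esub> b) 1 - Poly_Mapping.single (a, b) c
        |c a b. a \<in> carrier A \<and> b \<in> carrier B}"

text \<open>The \<open>'k\<close>-span of the bilinearity relations is closed under multiplication by pairs, hence
  agrees with the ideal they generate.\<close>

definition tensor_ideal ::
    "('k::comm_ring_1, 'a) module \<Rightarrow> ('k, 'b) module \<Rightarrow> (('a \<times> 'b) \<Rightarrow>\<^sub>0 'k) set" where
  "tensor_ideal A B = genideal (free_pair_alg A B) (bilinear_rels A B)"

definition tensor_alg ::
    "('k::comm_ring_1, 'a) module \<Rightarrow> ('k, 'b) module \<Rightarrow> ('k, (('a \<times> 'b) \<Rightarrow>\<^sub>0 'k) set) module" where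
  "tensor_alg A B = quot_alg (free_pair_alg A B) (tensor_ideal A B)"

definition pure_tensor ::
    "('k::comm_ring_1, 'a) module \<Rightarrow> ('k, 'b) module \<Rightarrow> 'a \<Rightarrow> 'b \<Rightarrow> (('a \<times> 'b) \<Rightarrow>\<^sub>0 'k) set" where
  "pure_tensor A B a b =
     tensor_ideal A B +>\<^bsub>free_pair_alg A B\<^esub> Poly_Mapping.single (a, b) 1"

subsection \<open>Projective limits over pairs of positive integers\<close>

definition pos_pairs :: "(nat \<times> nat) set" where
  "pos_pairs = {(m, n). 1 \<le> m \<and> 1 \<le> n}"

text \<open>\<open>f m' n' m n\<close> is the transition map \<open>A m' n' \<rightarrow> A m n\<close> for \<open>m' \<ge> m\<close>, \<open>n' \<ge> n\<close>. Elements
  of the limit are extensional functions on \<open>pos_pairs\<close>.\<close>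

definition proj_lim ::
    "(nat \<Rightarrow> nat \<Rightarrow> ('k, 'a) module) \<Rightarrow> (nat \<Rightarrow> nat \<Rightarrow> nat \<Rightarrow> nat \<Rightarrow> 'a \<Rightarrow> 'a) \<Rightarrow>
     ('k, nat \<times> nat \<Rightarrow> 'a) module" where
  "proj_lim A f =
     \<lparr>carrier = {x \<in> (\<Pi>\<^sub>E (m, n)\<in>pos_pairs. carrier (A m n)).
        \<forall>m' n' m n. 1 \<le> m \<and> m \<le> m' \<and> 1 \<le> n \<and> n \<le> n' \<longrightarrow>
          f m' n' m n (x (m', n')) = x (m, n)},
      monoid.mult = (\<lambda>x y. \<lambda>(m, n)\<in>pos_pairs. x (m, n) \<otimes>\<^bsub>A m n\<^esub> y (m, n)),
      one = (\<lambda>(m, n)\<in>pos_pairs. \<one>\<^bsub>A m n\<^esub>),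
      zero = (\<lambda>(m, n)\<in>pos_pairs. \<zero>\<^bsub>A m n\<^esub>),
      add = (\<lambda>x y. \<lambda>(m, n)\<in>pos_pairs. x (m, n) \<oplus>\<^bsub>A m n\<^esub> y (m, n)),
      module.smult = (\<lambda>c x. \<lambda>(m, n)\<in>pos_pairs. c \<odot>\<^bsub>A m n\<^esub> x (m, n))\<rparr>"

section \<open>Infinite matrices and their maximal minors\<close>

text \<open>The variable \<open>b\<^sub>i\<^sub>j\<close> (and likewise \<open>g\<^sub>i\<^sub>j\<close>) is \<open>mvar (i, j)\<close>.\<close>

definition kb :: "nat \<Rightarrow> nat \<Rightarrow> ('k::comm_ring_1, (int \<times> int, 'k) mpol) module" where
  "kb m n = poly_alg ({- int m .. int n - 1} \<times> {- int m .. -1})"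

definition E_map ::
    "nat \<Rightarrow> nat \<Rightarrow> nat \<Rightarrow> nat \<Rightarrow> (int \<times> int, 'k::comm_ring_1) mpol \<Rightarrow> (int \<times> int, 'k) mpol" where
  "E_map m' n' m n = alg_eval (kb m n)
     (\<lambda>(i, j). if i \<in> {- int m .. int n - 1} \<and> j \<in> {- int m .. -1} then mvar (i, j)
               else if i = j \<and> i \<in> {- int m' .. - int m - 1} then 1
               else 0)"

definition kM_inf :: "('k::comm_ring_1, nat \<times> nat \<Rightarrow> (int \<times> int, 'k) mpol) module" where
  "kM_inf = proj_lim kb E_map"

text \<open>The determinant with rows \<open>l 0, \<dots>, l (m - 1)\<close> and columns \<open>-m, \<dots>, -1\<close>.\<close>

definition row_det :: "nat \<Rightarrow> (nat \<Rightarrow> int) \<Rightarrow> (int \<times> int, 'k::comm_ring_1) mpol" where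
  "row_det m l = det (mat m m (\<lambda>(r, c). mvar (l r, int c - int m)))"

definition kdelta :: "nat \<Rightarrow> nat \<Rightarrow> ('k::comm_ring_1, (int \<times> int, 'k) mpol) module" where
  "kdelta m n = gen_subalg (kb m n)
     {row_det m l |l. strict_mono_on {..<m} l \<and> l ` {..<m} \<subseteq> {- int m .. int n - 1}}"

definition e_map ::
    "nat \<Rightarrow> nat \<Rightarrow> nat \<Rightarrow> nat \<Rightarrow> (int \<times> int, 'k::comm_ring_1) mpol \<Rightarrow> (int \<times> int, 'k) mpol" where
  "e_map m' n' m n = restrict (E_map m' n' m n) (carrier (kdelta m' n'))"

definition kdelta_inf :: "('k::comm_ring_1, nat \<times> nat \<Rightarrow> (int \<times> int, 'k) mpol) module" where
  "kdelta_inf = proj_lim kdelta e_map"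

section \<open>The coaction of the special linear group\<close>

text \<open>The coordinate ring of \<open>SL\<^sub>m\<^sub>,\<^sub>0\<close> is the quotient of the polynomial ring in the \<open>g\<^sub>i\<^sub>j\<close>,
  \<open>-m \<le> i, j \<le> -1\<close>, by the ideal generated by \<open>det (g\<^sub>i\<^sub>j) - 1\<close>.\<close>

definition kMat :: "nat \<Rightarrow> ('k::comm_ring_1, (int \<times> int, 'k) mpol) module" where
  "kMat m = poly_alg ({- int m .. -1} \<times> {- int m .. -1})"

definition SL_ideal :: "nat \<Rightarrow> (int \<times> int, 'k::comm_ring_1) mpol set" where
  "SL_ideal m = genideal (kMat m) {row_det m (\<lambda>r. int r - int m) - 1}"

definition kSL :: "nat \<Rightarrow> ('k::comm_ring_1, (int \<times> int, 'k) mpol set) module" where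
  "kSL m = quot_alg (kMat m) (SL_ideal m)"

definition SL_coord :: "nat \<Rightarrow> int \<Rightarrow> int \<Rightarrow> (int \<times> int, 'k::comm_ring_1) mpol set" where
  "SL_coord m i j = SL_ideal m +>\<^bsub>kMat m\<^esub> mvar (i, j)"

type_synonym 'k tens =
  "(((int \<times> int, 'k) mpol \<times> (int \<times> int, 'k) mpol set) \<Rightarrow>\<^sub>0 'k) set"

definition rho :: "nat \<Rightarrow> nat \<Rightarrow> (int \<times> int, 'k::comm_ring_1) mpol \<Rightarrow> 'k tens" where
  "rho m n = alg_eval (tensor_alg (kb m n) (kSL m))
     (\<lambda>(i, j). \<Oplus>\<^bsub>tensor_alg (kb m n) (kSL m)\<^esub>k\<in>{- int m .. -1}.
        pure_tensor (kb m n) (kSL m) (mvar (i, k)) (SL_coord m k j))"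

text \<open>An element of the completed tensor product is a compatible family of elements of the
  tensor products at the levels \<open>(m, n)\<close>, so two elements are equal iff the families are.\<close>

definition rho_inf ::
    "(nat \<times> nat \<Rightarrow> (int \<times> int, 'k::comm_ring_1) mpol) \<Rightarrow> nat \<times> nat \<Rightarrow> 'k tens" where
  "rho_inf x = (\<lambda>(m, n)\<in>pos_pairs. rho m n (x (m, n)))"

definition tensor_one_inf ::
    "(nat \<times> nat \<Rightarrow> (int \<times> int, 'k::comm_ring_1) mpol) \<Rightarrow> nat \<times> nat \<Rightarrow> 'k tens" where
  "tensor_one_inf x =
     (\<lambda>(m, n)\<in>pos_pairs. pure_tensor (kb m n) (kSL m) (x (m, n)) \<one>\<^bsub>kSL m\<^esub>)"

definition coinvariants :: "('k::comm_ring_1, nat \<times> nat \<Rightarrow> (int \<times> int, 'k) mpol) module" where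
  "coinvariants = kM_inf\<lparr>carrier := {x \<in> carrier kM_inf. rho_inf x = tensor_one_inf x}\<rparr>"

end

(*
  At a finite level, let X be a generic square matrix with determinant D, and let B be the matrix
  of variables b_ij. If p is coinvariant, then p(BX) is congruent to p(B) modulo D - 1 in k[B][X].
  The Reynolds operator F |-> sum_d <D^d, F> / <D^d, D^d>, with <f, g> = sum_t f_t g_t t! the apolar
  pairing in the variables X, kills multiples of D - 1, because <D^(e+1), D h> is proportional to
  <D^e, h> (the qualitative form of Cayley's identity). Hence p(B) is a linear combination of the
  <D^d, p(BX)>. As substitution is adjoint to transposed substitution, <D^d, p(BX)> equals
  <det(B^T Y)^d, p(Y)>, and the coefficients of det(B^T Y) as a polynomial in Y are maximal minors
  of B.
*)
theory Submission
  imports Defs "HOL-Library.Product_Lexorder"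
begin

text \<open>Averaging over the group is the usual source of a Reynolds operator; here finitely many
  apolar pairings replace it, so everything stays an identity between polynomials. The ratio in
  Cayley's identity never has to be computed: taking h = D^e shows that it is <D^(e+1), D^(e+1)>
  divided by <D^e, D^e>, which is exactly what makes the sum telescope. Two facts about powers of D
  remain: <D^d, D^d> is nonzero (the field carries no order, so this is read off from integer
  coefficients), and only finitely many d contribute to a given F (for m >= 1, D^d has no monomial
  of degree below d).

  The second obstacle is that the tensor product is a quotient of a formal free algebra, and its
  right factor is again a quotient. No map out of it is defined directly; its elements are related
  to polynomials in k[B][X] by a relation that respects sums and products and is single-valued
  modulo D - 1. The easy inclusion, that minors are coinvariant, goes the other way, through a
  polynomial ring that maps to the tensor product.\<close>

abbreviation "lookup \<equiv> Poly_Mapping.lookup"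
abbreviation "keys \<equiv> Poly_Mapping.keys"

section \<open>Polynomials\<close>

definition mconst :: "'k::comm_ring_1 \<Rightarrow> ('v, 'k) mpol" where
  "mconst c = Poly_Mapping.single 0 c"

lemma comm_ring_hom_mconst: "comm_ring_hom mconst"
  by unfold_locales (simp_all add: mconst_def single_add mult_single)

interpretation mconst: comm_ring_hom mconst
  by (rule comm_ring_hom_mconst)

lemma lookup_mconst_mult: "lookup (mconst c * p) t = c * lookup p t"
  by (simp add: mconst_def mult_map_scale_conv_mult [symmetric] map.rep_eq when_def)

lemma mconst_eq_iff [simp]: "mconst c = mconst d \<longleftrightarrow> c = d"
  by (metis mconst_def lookup_single_eq)

lemma sum_single_lookup: "(\<Sum>t\<in>keys p. Poly_Mapping.single t (lookup p t)) = p"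
  by (rule poly_mapping_eqI)
    (auto simp: lookup_sum lookup_single when_def in_keys_iff)

lemma poly_mapping_single_induct [consumes 1, case_names single add zero]:
  assumes "keys p \<subseteq> K"
    and single: "\<And>t c. t \<in> K \<Longrightarrow> P (Poly_Mapping.single t c)"
    and add: "\<And>p q. keys p \<subseteq> K \<Longrightarrow> keys q \<subseteq> K \<Longrightarrow> P p \<Longrightarrow> P q \<Longrightarrow> P (p + q)"
    and zero: "P 0"
  shows "P (p :: 'a \<Rightarrow>\<^sub>0 'b::comm_monoid_add)"
proof -
  have "P (\<Sum>t\<in>T. Poly_Mapping.single t (lookup p t)) \<and>
      keys (\<Sum>t\<in>T. Poly_Mapping.single t (lookup p t)) \<subseteq> K"
    if "finite T" "T \<subseteq> K" for T
    using that
  proof (induction T rule: finite_induct)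
    case empty
    then show ?case by (simp add: zero)
  next
    case (insert t T)
    then have "P (Poly_Mapping.single t (lookup p t) + (\<Sum>t\<in>T. Poly_Mapping.single t (lookup p t)))"
      by (intro add single) auto
    then show ?case
      using insert keys_add [of "Poly_Mapping.single t (lookup p t)"
          "\<Sum>t\<in>T. Poly_Mapping.single t (lookup p t)"]
      by (auto split: if_splits)
  qed
  from this [OF _ assms(1)] show ?thesis
    by (simp add: sum_single_lookup)
qed

lemma single_eq_prod_mvar:
  fixes c :: "'k::comm_ring_1" and t :: "'v \<Rightarrow>\<^sub>0 nat"
  shows "Poly_Mapping.single t c = mconst c * (\<Prod>v\<in>keys t. mvar v ^ lookup t v)"
proof -
  have pow: "mvar v ^ n = Poly_Mapping.single (Poly_Mapping.single v n) (1::'k)" for v :: 'v and n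
    by (induction n) (simp_all add: mvar_def mult_single single_add [symmetric])
  have "(\<Prod>v\<in>V. mvar v ^ lookup t v) = Poly_Mapping.single (\<Sum>v\<in>V. Poly_Mapping.single v (lookup t v)) (1::'k)"
    if "finite V" for V
    using that by (induction V rule: finite_induct) (simp_all add: pow mult_single)
  then show ?thesis
    by (simp add: mconst_def mult_single sum_single_lookup)
qed

text \<open>Peels off one variable at a time, by induction on the degree of a monomial. This form
  fits the adjointness proofs, where multiplication by a single variable is what can be moved across
  the pairing.\<close>

lemma mpol_mvar_induct [consumes 1, case_names mconst mvar add]:
  assumes "p \<in> carrier (poly_alg V)"
    and const: "\<And>c. P (mconst c)"
    and var: "\<And>v q. v \<in> V \<Longrightarrow> q \<in> carrier (poly_alg V) \<Longrightarrow> P q \<Longrightarrow> P (mvar v * q)"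
    and add: "\<And>p q. p \<in> carrier (poly_alg V) \<Longrightarrow> q \<in> carrier (poly_alg V) \<Longrightarrow> P p \<Longrightarrow> P q \<Longrightarrow> P (p + q)"
  shows "P p"
proof -
  have single: "P (Poly_Mapping.single t c)" if "keys t \<subseteq> V" for t c
    using that
  proof (induction "\<Sum>v\<in>keys t. lookup t v" arbitrary: t rule: less_induct)
    case less
    show ?case
    proof (cases "t = 0")
      case True
      then show ?thesis using const by (simp add: mconst_def)
    next
      case False
      then obtain v where v: "v \<in> keys t" by (metis keys_eq_empty ex_in_conv)
      define s where "s = t - Poly_Mapping.single v 1"
      have t: "t = Poly_Mapping.single v 1 + s"
        using v by (intro poly_mapping_eqI)
          (auto simp: s_def lookup_add lookup_minus lookup_single when_def in_keys_iff)
      have keys: "keys s \<subseteq> keys t"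
        by (auto simp: s_def in_keys_iff lookup_minus)
      have "(\<Sum>w\<in>keys s. lookup s w) = (\<Sum>w\<in>keys t. lookup s w)"
        by (intro sum.mono_neutral_left keys) (auto simp: in_keys_iff)
      also have "\<dots> < (\<Sum>w\<in>keys t. lookup t w)"
        by (rule sum_strict_mono2 [of _ _ v] sum_strict_mono_ex1)
          (use v in \<open>auto simp: t lookup_add intro!: bexI [of _ v]\<close>)
      finally have "P (Poly_Mapping.single s c)"
        using less keys by blast
      then have "P (mvar v * Poly_Mapping.single s c)"
        using less v keys by (intro var) (auto simp: poly_alg_def)
      then show ?thesis
        by (simp add: t mvar_def mult_single)
    qed
  qed
  have "keys p \<subseteq> {t. keys t \<subseteq> V}"
    using assms(1) by (auto simp: poly_alg_def)
  then show ?thesis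
  proof (induction p rule: poly_mapping_single_induct)
    case (single t c)
    then show ?case using \<open>\<And>t c. keys t \<subseteq> V \<Longrightarrow> P (Poly_Mapping.single t c)\<close> by simp
  next
    case (add p q)
    then show ?case by (intro assms(4)) (auto simp: poly_alg_def)
  next
    case zero
    show ?case using const [of 0] by simp
  qed
qed

lemma mpol_UNIV_induct [case_names mconst mvar add]:
  assumes "\<And>c. P (mconst c)" "\<And>v q. P q \<Longrightarrow> P (mvar v * q)"
    "\<And>p q. P p \<Longrightarrow> P q \<Longrightarrow> P (p + q)"
  shows "P p"
  by (rule mpol_mvar_induct [of p UNIV]) (auto simp: poly_alg_def assms)

text \<open>Class-based counterpart of \<open>alg_eval\<close>. The separate coefficient map
  \<open>\<sigma>\<close> allows substitutions that also change the coefficient ring, in particular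
  to polynomials over polynomials; with \<open>mconst\<close> it is plain substitution.\<close>

definition peval :: "('r::comm_ring_1 \<Rightarrow> 's::comm_ring_1) \<Rightarrow> ('v \<Rightarrow> 's) \<Rightarrow> ('v, 'r) mpol \<Rightarrow> 's" where
  "peval \<sigma> \<phi> p = (\<Sum>t\<in>keys p. \<sigma> (lookup p t) * (\<Prod>v\<in>keys t. \<phi> v ^ lookup t v))"

context comm_ring_hom
begin

lemma peval_superset:
  assumes "finite T" "keys p \<subseteq> T"
  shows "peval hom \<phi> p = (\<Sum>t\<in>T. hom (lookup p t) * (\<Prod>v\<in>keys t. \<phi> v ^ lookup t v))"
  unfolding peval_def using assms
  by (intro sum.mono_neutral_left) (auto simp: in_keys_iff)

lemma peval_add: "peval hom \<phi> (p + q) = peval hom \<phi> p + peval hom \<phi> q"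
proof -
  have "keys (p + q) \<subseteq> keys p \<union> keys q" by (rule keys_add)
  then show ?thesis
    by (simp add: peval_superset [of "keys p \<union> keys q"] lookup_add hom_add distrib_right sum.distrib)
qed

lemma peval_single:
  "peval hom \<phi> (Poly_Mapping.single t c) = hom c * (\<Prod>v\<in>keys t. \<phi> v ^ lookup t v)"
  by (simp add: peval_def)

lemma peval_zero: "peval hom \<phi> 0 = 0"
  by (simp add: peval_def)

lemma prod_lookup_superset:
  assumes "finite V" "keys t \<subseteq> V"
  shows "(\<Prod>v\<in>keys t. (\<phi> v :: 'b) ^ lookup t v) = (\<Prod>v\<in>V. \<phi> v ^ lookup t v)"
  using assms by (intro prod.mono_neutral_left) (auto simp: in_keys_iff)

lemma peval_mult_single:
  "peval hom \<phi> (Poly_Mapping.single s c * Poly_Mapping.single t d) =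
    peval hom \<phi> (Poly_Mapping.single s c) * peval hom \<phi> (Poly_Mapping.single t d)"
proof -
  have *: "(\<Prod>v\<in>keys u. \<phi> v ^ lookup u v) = (\<Prod>v\<in>keys s \<union> keys t. \<phi> v ^ lookup u v)"
    if "keys u \<subseteq> keys s \<union> keys t" for u
    using that by (intro prod_lookup_superset) auto
  show ?thesis
    unfolding mult_single peval_single hom_mult *[OF keys_add] *[OF Un_upper1] *[OF Un_upper2]
    by (simp add: lookup_add power_add prod.distrib mult_ac)
qed

lemma peval_mult: "peval hom \<phi> (p * q) = peval hom \<phi> p * peval hom \<phi> q"
proof (rule poly_mapping_single_induct [of p UNIV])
  show "peval hom \<phi> (Poly_Mapping.single s c * q) = peval hom \<phi> (Poly_Mapping.single s c) * peval hom \<phi> q"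
    for s c
    by (rule poly_mapping_single_induct [of q UNIV])
      (simp_all add: peval_mult_single peval_add distrib_left peval_zero)
qed (simp_all add: peval_add distrib_right peval_zero)

lemma comm_ring_hom_peval: "comm_ring_hom (peval hom \<phi>)"
  by unfold_locales
    (simp_all add: peval_add peval_mult peval_zero peval_single flip: single_one)

lemma peval_mvar [simp]: "peval hom \<phi> (mvar v) = \<phi> v"
  by (simp add: mvar_def peval_single)

lemma peval_mconst [simp]: "peval hom \<phi> (mconst c) = hom c"
  by (simp add: mconst_def peval_single)

end

text \<open>Constants and variables generate the ring. This turns comparisons of composed
  substitutions into a check on variables.\<close>

lemma peval_unique:
  assumes "comm_ring_hom f" "comm_ring_hom g" "p \<in> carrier (poly_alg V)"
    and "\<And>c. f (mconst c) = g (mconst c)" "\<And>v. v \<in> V \<Longrightarrow> f (mvar v) = g (mvar v)"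
  shows "f p = g p"
proof -
  interpret f: comm_ring_hom f by fact
  interpret g: comm_ring_hom g by fact
  from assms(3) show ?thesis
    by (induction p rule: mpol_mvar_induct) (simp_all add: assms(4,5) f.hom_add f.hom_mult g.hom_add g.hom_mult)
qed

lemma poly_alg_UNIV [simp]: "p \<in> carrier (poly_alg UNIV)"
  by (simp add: poly_alg_def)

lemma comm_ring_hom_comp: "comm_ring_hom f \<Longrightarrow> comm_ring_hom g \<Longrightarrow> comm_ring_hom (\<lambda>x. f (g x))"
  unfolding comm_ring_hom_def ring_hom_def semiring_hom_def comm_monoid_add_hom_def
    monoid_mult_hom_def monoid_add_hom_def semigroup_add_hom_def semigroup_mult_hom_def
  by (auto simp: zero_hom_def one_hom_def plus_hom_def times_hom_def)

lemma comm_ring_hom_id: "comm_ring_hom (\<lambda>x. x)"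
  by unfold_locales auto

section \<open>Extension of the coefficient ring\<close>

definition mmap :: "('r::comm_ring_1 \<Rightarrow> 's::comm_ring_1) \<Rightarrow> ('v, 'r) mpol \<Rightarrow> ('v, 's) mpol" where
  "mmap \<sigma> = peval (\<lambda>c. mconst (\<sigma> c)) mvar"

context comm_ring_hom
begin

lemma comm_ring_hom_mmap: "comm_ring_hom (mmap hom)"
  unfolding mmap_def
  by (rule comm_ring_hom.comm_ring_hom_peval [OF comm_ring_hom_comp [OF comm_ring_hom_mconst comm_ring_hom_axioms]])

lemma mmap_single: "mmap hom (Poly_Mapping.single t c) = Poly_Mapping.single t (hom c)"
proof -
  interpret c: comm_ring_hom "\<lambda>c. mconst (hom c)"
    by (rule comm_ring_hom_comp [OF comm_ring_hom_mconst comm_ring_hom_axioms])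
  show ?thesis
    by (simp add: mmap_def c.peval_single flip: single_eq_prod_mvar)
qed

lemma mmap_mconst [simp]: "mmap hom (mconst c) = mconst (hom c)"
  by (simp add: mconst_def mmap_single)

lemma mmap_mvar [simp]: "mmap hom (mvar v) = mvar v"
  by (simp add: mvar_def mmap_single)

lemma lookup_mmap: "lookup (mmap hom p) t = hom (lookup p t)"
proof -
  interpret mmap: comm_ring_hom "mmap hom" by (rule comm_ring_hom_mmap)
  show ?thesis
    by (rule poly_mapping_single_induct [of p UNIV])
      (simp_all add: mmap_single mmap.hom_add lookup_add hom_add lookup_single when_def)
qed

end

section \<open>The apolar pairing\<close>

definition mfact :: "('v \<Rightarrow>\<^sub>0 nat) \<Rightarrow> nat" where
  "mfact t = (\<Prod>v\<in>keys t. fact (lookup t v))"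

text \<open>The Fischer pairing: the constant term of what remains of g when f, with its variables
  read as partial derivatives, is applied to it.\<close>

definition pair :: "('v, 'r::comm_ring_1) mpol \<Rightarrow> ('v, 'r) mpol \<Rightarrow> 'r" where
  "pair f g = (\<Sum>t\<in>keys f. of_nat (mfact t) * lookup f t * lookup g t)"

text \<open>The subtraction of exponents truncates where v does not occur; the factor
  \<open>of_nat (lookup t v)\<close> is then 0, so the wrong monomial does no harm.\<close>

definition mderiv :: "'v \<Rightarrow> ('v, 'r::comm_ring_1) mpol \<Rightarrow> ('v, 'r) mpol" where
  "mderiv v f = (\<Sum>t\<in>keys f.
     Poly_Mapping.single (t - Poly_Mapping.single v 1) (of_nat (lookup t v) * lookup f t))"

lemma pair_superset:
  assumes "finite T" "keys f \<subseteq> T"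
  shows "pair f g = (\<Sum>t\<in>T. of_nat (mfact t) * lookup f t * lookup g t)"
  unfolding pair_def using assms by (intro sum.mono_neutral_left) (auto simp: in_keys_iff)

lemma pair_add_left: "pair (f + f') g = pair f g + pair f' g"
proof -
  have "keys (f + f') \<subseteq> keys f \<union> keys f'" by (rule keys_add)
  then show ?thesis
    by (simp add: pair_superset [of "keys f \<union> keys f'"] lookup_add algebra_simps sum.distrib)
qed

lemma pair_add_right: "pair f (g + g') = pair f g + pair f g'"
  by (simp add: pair_def lookup_add algebra_simps sum.distrib)

lemma pair_zero_left [simp]: "pair 0 g = 0"
  by (simp add: pair_def)

lemma pair_zero_right [simp]: "pair f 0 = 0"
  by (simp add: pair_def)

lemma pair_single_left:
  "pair (Poly_Mapping.single t c) g = of_nat (mfact t) * c * lookup g t"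
  by (simp add: pair_def)

lemma pair_single_right:
  "pair f (Poly_Mapping.single t c) = of_nat (mfact t) * lookup f t * c"
  by (subst pair_superset [of "insert t (keys f)"], simp, blast, subst sum.remove [of _ t])
    (auto simp: lookup_single when_def intro!: sum.neutral split: if_splits)

lemma mfact_0 [simp]: "mfact 0 = 1"
  by (simp add: mfact_def)

lemma pair_mconst_left [simp]: "pair (mconst c) g = c * lookup g 0"
  by (simp add: mconst_def pair_single_left)

lemma pair_mconst_right [simp]: "pair f (mconst c) = lookup f 0 * c"
  by (simp add: mconst_def pair_single_right)

lemma pair_mconst_mult_left: "pair (mconst c * f) g = c * pair f g"
proof -
  have "keys (mconst c * f) \<subseteq> keys f"
    by (auto simp: in_keys_iff lookup_mconst_mult)
  then show ?thesis
    by (simp add: pair_superset [of "keys f"] lookup_mconst_mult sum_distrib_left mult.left_commute mult.assoc)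
qed

lemma pair_mconst_mult_right: "pair f (mconst c * g) = c * pair f g"
  by (simp add: pair_def lookup_mconst_mult sum_distrib_left mult.left_commute)

lemma pair_sum_left: "pair (sum f A) g = (\<Sum>a\<in>A. pair (f a) g)"
  by (induction A rule: infinite_finite_induct) (simp_all add: pair_add_left)

lemma pair_sum_right: "pair f (sum g A) = (\<Sum>a\<in>A. pair f (g a))"
  by (induction A rule: infinite_finite_induct) (simp_all add: pair_add_right)

text \<open>Pairing with a monomial reads off a coefficient up to the factor t!, which is nonzero in
  characteristic 0. The coefficients form only a domain, since polynomial coefficients occur
  later.\<close>

lemma pair_eqI:
  fixes f g :: "('v, 'r::{idom, ring_char_0}) mpol"
  assumes "\<And>h. pair f h = pair g h"
  shows "f = g"
proof (rule poly_mapping_eqI)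
  fix t :: "'v \<Rightarrow>\<^sub>0 nat"
  have "(of_nat (mfact t) :: 'r) \<noteq> 0"
    by (simp add: mfact_def)
  with assms [of "Poly_Mapping.single t 1"] show "lookup f t = lookup g t"
    by (simp add: pair_single_right)
qed

lemma (in comm_ring_hom) pair_mmap: "pair (mmap hom f) (mmap hom g) = hom (pair f g)"
proof -
  have "keys (mmap hom f) \<subseteq> keys f"
    by (auto simp: in_keys_iff lookup_mmap)
  then show ?thesis
    by (subst pair_superset [of "keys f"]) (simp_all add: lookup_mmap pair_def hom_distribs)
qed

section \<open>Partial derivatives as adjoints of the variables\<close>

lemma mderiv_superset:
  assumes "finite T" "keys f \<subseteq> T"
  shows "mderiv v f = (\<Sum>t\<in>T.
     Poly_Mapping.single (t - Poly_Mapping.single v 1) (of_nat (lookup t v) * lookup f t))"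
  unfolding mderiv_def using assms by (intro sum.mono_neutral_left) (auto simp: in_keys_iff)

lemma mderiv_add: "mderiv v (f + g) = mderiv v f + mderiv v g"
proof -
  have "keys (f + g) \<subseteq> keys f \<union> keys g" by (rule keys_add)
  then show ?thesis
    by (simp add: mderiv_superset [of "keys f \<union> keys g"] lookup_add algebra_simps sum.distrib single_add)
qed

lemma mderiv_zero [simp]: "mderiv v 0 = 0"
  by (simp add: mderiv_def)

lemma mderiv_single:
  "mderiv v (Poly_Mapping.single t c) =
    Poly_Mapping.single (t - Poly_Mapping.single v 1) (of_nat (lookup t v) * c)"
  by (simp add: mderiv_def)

lemma mderiv_mconst [simp]: "mderiv v (mconst c) = 0"
  by (simp add: mconst_def mderiv_single)

lemma mderiv_mvar: "mderiv v (mvar w) = (if v = w then 1 else 0)"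
  by (auto simp: mvar_def mderiv_single lookup_single)

lemma mderiv_mult:
  fixes f g :: "('v, 'r::comm_ring_1) mpol"
  shows "mderiv v (f * g) = mderiv v f * g + f * mderiv v g"
proof -
  have single: "mderiv v (Poly_Mapping.single s c * Poly_Mapping.single t d) =
      mderiv v (Poly_Mapping.single s c) * Poly_Mapping.single t d +
      Poly_Mapping.single s c * mderiv v (Poly_Mapping.single t d)" for s t and c d :: 'r
  proof -
    \<comment> \<open>Truncated subtraction moves past a sum only if v occurs in the factor
      concerned; otherwise that factor contributes a derivative with coefficient 0.\<close>
    have "lookup s v > 0 \<Longrightarrow> s + t - Poly_Mapping.single v 1 = s - Poly_Mapping.single v 1 + t"
      "lookup t v > 0 \<Longrightarrow> s + t - Poly_Mapping.single v 1 = s + (t - Poly_Mapping.single v 1)"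
      by (auto intro!: poly_mapping_eqI simp: lookup_add lookup_minus lookup_single when_def)
    then show ?thesis
      by (cases "lookup s v = 0"; cases "lookup t v = 0")
        (simp_all add: mderiv_single mult_single lookup_add algebra_simps flip: single_add)
  qed
  show ?thesis
  proof (rule poly_mapping_single_induct [of f UNIV])
    show "mderiv v (Poly_Mapping.single s c * g) =
        mderiv v (Poly_Mapping.single s c) * g + Poly_Mapping.single s c * mderiv v g" for s c
      by (rule poly_mapping_single_induct [of g UNIV])
        (simp_all add: single mderiv_add algebra_simps)
  qed (simp_all add: mderiv_add algebra_simps)
qed

lemma mfact_add_single:
  "mfact (t + Poly_Mapping.single v 1) = (lookup t v + 1) * mfact t"
proof -
  let ?s = "t + Poly_Mapping.single v 1"
  have *: "(\<Prod>w\<in>keys u. fact (lookup u w) :: nat) = (\<Prod>w\<in>insert v (keys t). fact (lookup u w))"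
    if "keys u \<subseteq> insert v (keys t)" for u
    using that by (intro prod.mono_neutral_left) (auto simp: in_keys_iff)
  have "(\<Prod>w\<in>insert v (keys t). fact (lookup ?s w) :: nat) =
      fact (lookup ?s v) * (\<Prod>w\<in>insert v (keys t) - {v}. fact (lookup ?s w))"
    by (intro prod.remove) auto
  also have "(\<Prod>w\<in>insert v (keys t) - {v}. fact (lookup ?s w) :: nat) = (\<Prod>w\<in>insert v (keys t) - {v}. fact (lookup t w))"
    by (intro prod.cong) (auto simp: lookup_add lookup_single)
  also have "fact (lookup ?s v) = (lookup t v + 1) * (fact (lookup t v) :: nat)"
    by (simp add: lookup_add)
  also have "(lookup t v + 1) * fact (lookup t v) * (\<Prod>w\<in>insert v (keys t) - {v}. fact (lookup t w)) =
      (lookup t v + 1) * (\<Prod>w\<in>insert v (keys t). fact (lookup t w) :: nat)"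
    by (subst (2) prod.remove [of _ v]) (auto simp: algebra_simps)
  finally show ?thesis
    using * [of "t + Poly_Mapping.single v 1"] * [of t] keys_add [of t "Poly_Mapping.single v 1"]
    by (auto simp: mfact_def subset_insertI)
qed

text \<open>On monomials s and t both sides vanish unless s = t + v, and there the weights match
  because (t + v)! is t! times the new exponent of v.\<close>

lemma pair_mvar_mult:
  fixes f g :: "('v, 'r::comm_ring_1) mpol"
  shows "pair f (mvar v * g) = pair (mderiv v f) g"
proof -
  have single: "pair (Poly_Mapping.single s c) (mvar v * Poly_Mapping.single t d) =
      pair (mderiv v (Poly_Mapping.single s c)) (Poly_Mapping.single t d)" for s t and c d :: 'r
  proof (cases "s = t + Poly_Mapping.single v 1")
    case True
    then have "s - Poly_Mapping.single v 1 = t" by simp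
    then show ?thesis
      using True
      by (simp add: mvar_def mult_single mderiv_single pair_single_left add.commute [of "Poly_Mapping.single v 1"]
          mfact_add_single [unfolded One_nat_def] lookup_add lookup_single algebra_simps)
  next
    case False
    \<comment> \<open>Without s = t + v this equality can only come from truncation at exponent 0,
      and the derivative is then zero.\<close>
    have "t = s - Poly_Mapping.single v 1 \<Longrightarrow> lookup s v = 0"
    proof (rule ccontr)
      assume "t = s - Poly_Mapping.single v 1" "lookup s v \<noteq> 0"
      then have "s = t + Poly_Mapping.single v 1"
        by (intro poly_mapping_eqI) (auto simp: lookup_add lookup_minus lookup_single when_def)
      with False show False ..
    qed
    then show ?thesis
      using False
      by (auto simp: mvar_def mult_single mderiv_single pair_single_left lookup_single when_def add.commute)
  qed
  show ?thesis
  proof (rule poly_mapping_single_induct [of f UNIV])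
    show "pair (Poly_Mapping.single s c) (mvar v * g) = pair (mderiv v (Poly_Mapping.single s c)) g" for s c
      by (rule poly_mapping_single_induct [of g UNIV])
        (simp_all add: single pair_add_right algebra_simps)
  qed (simp_all add: mderiv_add pair_add_left)
qed

text \<open>The adjoint of multiplication by q is the differential operator obtained from q. Only
  its existence matters, with \<open>f'\<close> independent of \<open>h\<close>.\<close>

lemma pair_mult_adjoint: "\<exists>f'. \<forall>h. pair f (q * h) = pair f' h"
proof (induction q arbitrary: f rule: mpol_UNIV_induct)
  case (mconst c)
  have "pair f (mconst c * h) = pair (mconst c * f) h" for h
    by (simp add: pair_mconst_mult_left pair_mconst_mult_right)
  then show ?case by blast
next
  case (mvar v q)
  have "pair f (mvar v * q * h) = pair (mderiv v f) (q * h)" for h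
    by (simp add: mult.assoc pair_mvar_mult)
  then show ?case using mvar [of "mderiv v f"] by simp
next
  case (add p q)
  then obtain f1 f2 where "\<forall>h. pair f (p * h) = pair f1 h" "\<forall>h. pair f (q * h) = pair f2 h"
    by meson
  then have "pair f ((p + q) * h) = pair (f1 + f2) h" for h
    by (simp add: distrib_right pair_add_left pair_add_right)
  then show ?case by blast
qed

section \<open>Generic determinants\<close>

abbreviation gdet :: "nat \<Rightarrow> (int \<times> int, 'k::comm_ring_1) mpol" where
  "gdet m \<equiv> row_det m (\<lambda>r. int r - int m)"

lemma (in comm_ring_hom) peval_row_det:
  "peval hom \<phi> (row_det m l) = det (mat m m (\<lambda>(r, c). \<phi> (l r, int c - int m)))"
proof -
  interpret p: comm_ring_hom "peval hom \<phi>" by (rule comm_ring_hom_peval)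
  show ?thesis
    unfolding row_det_def p.hom_det [symmetric]
    by (intro arg_cong [of _ _ det] eq_matI) auto
qed

lemma (in comm_ring_hom) mmap_row_det: "mmap hom (row_det m l) = row_det m l"
proof -
  interpret p: comm_ring_hom "mmap hom" by (rule comm_ring_hom_mmap)
  show ?thesis
    unfolding row_det_def p.hom_det [symmetric]
    by (intro arg_cong [of _ _ det] eq_matI) auto
qed

lemma sum_neg_interval: "(\<Sum>k\<in>{- int m..-1}. f k) = (\<Sum>r = 0..<m. f (int r - int m))"
  by (rule sum.reindex_bij_witness [of _ "\<lambda>r. int r - int m" "\<lambda>k. nat (k + int m)"]) auto

text \<open>Multiplicativity of the determinant, in the shape in which linear substitutions and the
  coaction produce matrix entries.\<close>

lemma det_sum_prod:
  "det (mat m m (\<lambda>(r, c). \<Sum>k\<in>{- int m..-1}. A r k * B k c)) =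
    det (mat m m (\<lambda>(r, c). A r (int c - int m))) * det (mat m m (\<lambda>(r, c). B (int r - int m) c))"
  by (subst det_mult [symmetric, of _ m])
    (auto intro!: arg_cong [of _ _ det] eq_matI simp: sum_neg_interval scalar_prod_def)

text \<open>The value at the identity matrix is 1.\<close>

lemma gdet_neq_0 [simp]: "gdet m \<noteq> (0 :: (int \<times> int, 'k::comm_ring_1) mpol)"
proof
  let ?\<delta> = "\<lambda>(i, j). if i = j then 1 else 0 :: 'k"
  assume "gdet m = (0 :: (int \<times> int, 'k) mpol)"
  then have "peval (\<lambda>x. x) ?\<delta> (gdet m) = (0::'k)"
    by (simp only: comm_ring_hom.peval_zero [OF comm_ring_hom_id])
  moreover have "mat m m (\<lambda>(r, c). ?\<delta> (int r - int m, int c - int m)) = 1\<^sub>m m"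
    by (intro eq_matI) auto
  ultimately show False
    unfolding comm_ring_hom.peval_row_det [OF comm_ring_hom_id] by simp
qed

text \<open>Expanding a determinant by rows yields row sequences in any order, whereas the
  generators have increasing rows; sorting costs only a sign.\<close>

lemma row_det_inj_sort:
  assumes inj: "inj_on f {0..<m}"
  obtains l c where "strict_mono_on {..<m} l" "l ` {..<m} = f ` {..<m}"
    "row_det m f = mconst (c :: 'k::comm_ring_1) * row_det m l"
proof -
  let ?L = "sorted_list_of_set (f ` {..<m})"
  have len: "length ?L = m"
    using inj by (simp add: card_image lessThan_atLeast0)
  define l where "l r = ?L ! r" for r
  have mono: "strict_mono_on {..<m} l"
    using strict_sorted_list_of_set [of "f ` {..<m}"] len
    by (auto simp: strict_mono_on_def l_def sorted_wrt_iff_nth_less)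
  have img: "l ` {..<m} = f ` {..<m}"
  proof -
    have "set ?L = f ` {..<m}" by simp
    then show ?thesis
      using len unfolding l_def by (metis (no_types, lifting) list.set_map map_nth set_upt atLeast_upt)
  qed
  have injl: "inj_on l {..<m}"
    using mono by (rule strict_mono_on_imp_inj_on)
  \<comment> \<open>\<open>q r\<close> is the position of the row \<open>f r\<close> in the sorted
    list; being the identity from \<open>m\<close> on makes it a permutation.\<close>
  define q where "q r = (if r < m then the_inv_into {..<m} l (f r) else r)" for r
  have q: "q r < m" "l (q r) = f r" if "r < m" for r
    using that img f_the_inv_into_f [OF injl, of "f r"] the_inv_into_into [OF injl, of "f r" "{..<m}"]
    by (auto simp: q_def)
  have "inj_on q {0..<m}"
    by (intro inj_onI) (metis atLeastLessThan_iff inj inj_onD q(2))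
  then have "bij_betw q {0..<m} {0..<m}"
    using q(1) by (intro bij_betw_imageI endo_inj_surj) auto
  then have perm: "q permutes {0..<m}"
    by (rule bij_imp_permutes) (simp add: q_def)
  have "row_det m f = signof q * (row_det m l :: (int \<times> int, 'k) mpol)"
    unfolding row_det_def
    by (subst det_permute_rows [OF _ perm, symmetric])
      (use q in \<open>auto intro!: arg_cong [of _ _ det] eq_matI\<close>)
  \<comment> \<open>The sign arises in the polynomial ring and has to be recognised as a
    scalar.\<close>
  moreover have "signof q = (mconst (signof q) :: (int \<times> int, 'k) mpol)"
    by (simp add: mconst.hom_signof)
  ultimately have "row_det m f = mconst (signof q :: 'k) * row_det m l"
    by (rule back_subst [OF _ arg_cong [where f = "\<lambda>x. row_det m f = x * row_det m l"]])
  with that mono img show thesis by blast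
qed

lemma row_det_not_inj:
  assumes "\<not> inj_on f {0..<m}"
  shows "row_det m f = 0"
proof -
  from assms obtain i j where "i < m" "j < m" "i \<noteq> j" "f i = f j"
    by (auto simp: inj_on_def)
  then have "row (mat m m (\<lambda>(r, c). mvar (f r, int c - int m))) i =
      row (mat m m (\<lambda>(r, c). mvar (f r, int c - int m))) j"
    by (intro eq_vecI) simp_all
  with \<open>i < m\<close> \<open>j < m\<close> \<open>i \<noteq> j\<close> show ?thesis
    unfolding row_det_def by (intro det_identical_rows [of _ m i j]) simp_all
qed

section \<open>Linear substitutions\<close>

text \<open>With b an I x J matrix and X a J x J matrix of variables, the variable (i, j) becomes an
  entry of b X. Sending all other variables to 0 lets adjointness hold without conditions on the
  polynomials.\<close>

definition rsub :: "int set \<Rightarrow> int set \<Rightarrow> (int \<Rightarrow> int \<Rightarrow> 'r) \<Rightarrow> int \<times> int \<Rightarrow> (int \<times> int, 'r::comm_ring_1) mpol" where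
  "rsub I J b = (\<lambda>(i, j). if i \<in> I \<and> j \<in> J then \<Sum>k\<in>J. mconst (b i k) * mvar (k, j) else 0)"

text \<open>The transposed direction: J x J variables become the entries of b^T Y, with Y an I x J
  matrix of variables.\<close>

definition csub :: "int set \<Rightarrow> int set \<Rightarrow> (int \<Rightarrow> int \<Rightarrow> 'r) \<Rightarrow> int \<times> int \<Rightarrow> (int \<times> int, 'r::comm_ring_1) mpol" where
  "csub I J b = (\<lambda>(k, l). if k \<in> J \<and> l \<in> J then \<Sum>i\<in>I. mconst (b i k) * mvar (i, l) else 0)"

lemma mderiv_sum: "mderiv v (sum f A) = (\<Sum>a\<in>A. mderiv v (f a))"
  by (induction A rule: infinite_finite_induct) (simp_all add: mderiv_add)

lemma mderiv_csub:
  assumes "finite I" "finite J"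
  shows "mderiv (i, j) (csub I J b v) =
    (if i \<in> I \<and> j \<in> J then \<Sum>k\<in>J. mconst (b i k) * (if (k, j) = v then 1 else 0) else 0)"
proof -
  obtain k' l' where v: "v = (k', l')" by (cases v)
  have "(\<Sum>a\<in>I. mconst (b a k') * mderiv (i, j) (mvar (a, l'))) =
      (\<Sum>a\<in>I. if i = a then (if j = l' then mconst (b i k') else 0) else 0)"
    by (intro sum.cong) (auto simp: mderiv_mvar)
  moreover have "(\<Sum>k\<in>J. mconst (b i k) * (if (k, j) = v then 1 else 0)) =
      (\<Sum>k\<in>J. if k = k' then (if j = l' then mconst (b i k') else 0) else 0)"
    by (intro sum.cong) (auto simp: v)
  ultimately show ?thesis
    using assms by (auto simp: v csub_def mderiv_sum mderiv_mult)
qed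

text \<open>Chain rule for a linear substitution: the variable (i, j) occurs only in the entries (k,
  j) of b^T Y, with coefficient \<open>b i k\<close>.\<close>

lemma mderiv_peval_csub:
  assumes "finite I" "finite J"
  shows "mderiv (i, j) (peval mconst (csub I J b) f) =
    (if i \<in> I \<and> j \<in> J then \<Sum>k\<in>J. mconst (b i k) * peval mconst (csub I J b) (mderiv (k, j) f) else 0)"
proof (induction f rule: mpol_UNIV_induct)
  case (mconst c)
  show ?case by (simp add: mconst.peval_zero)
next
  case (mvar v q)
  let ?S = "peval mconst (csub I J b)"
  interpret S: comm_ring_hom ?S by (rule mconst.comm_ring_hom_peval)
  have "?S (mderiv (k, j) (mvar v * q)) =
      (if (k, j) = v then 1 else 0) * ?S q + csub I J b v * ?S (mderiv (k, j) q)" for k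
    by (simp add: mderiv_mult mderiv_mvar S.hom_add S.hom_mult)
  then show ?case
    by (simp add: S.hom_mult mderiv_mult mvar mderiv_csub [OF assms] sum.distrib
        sum_distrib_left sum_distrib_right algebra_simps)
next
  case (add p q)
  then show ?case
    by (simp add: mconst.peval_add mderiv_add distrib_left sum.distrib)
qed

lemma lookup_mvar_0 [simp]: "lookup (mvar v) 0 = 0"
proof -
  have "Poly_Mapping.single v (1::nat) \<noteq> 0"
    by (metis lookup_single_eq lookup_zero one_neq_zero)
  then show ?thesis by (simp add: mvar_def lookup_single)
qed

lemma lookup_0_eq_peval:
  fixes p :: "('v, 'r::comm_ring_1) mpol"
  shows "lookup p 0 = peval (\<lambda>x. x) (\<lambda>_. 0) p"
proof -
  show ?thesis
  proof (rule poly_mapping_single_induct [of p UNIV])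
    show "lookup (Poly_Mapping.single t c) 0 = peval (\<lambda>x. x) (\<lambda>_. 0) (Poly_Mapping.single t c)" for t and c :: 'r
    proof (cases "t = 0")
      case False
      then obtain v where "v \<in> keys t" by (metis keys_eq_empty ex_in_conv)
      then have "(\<Prod>v\<in>keys t. 0 ^ lookup t v) = (0::'r)"
        by (intro prod_zero) (auto simp: in_keys_iff zero_power intro!: bexI [of _ v])
      with False show ?thesis by (simp add: comm_ring_hom.peval_single [OF comm_ring_hom_id] lookup_single)
    qed (simp add: comm_ring_hom.peval_single [OF comm_ring_hom_id])
  qed (simp_all add: lookup_add comm_ring_hom.peval_add [OF comm_ring_hom_id] comm_ring_hom.peval_zero [OF comm_ring_hom_id])
qed

lemma lookup_mult_0:
  fixes p q :: "('v, 'r::comm_ring_1) mpol"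
  shows "lookup (p * q) 0 = lookup p 0 * lookup q 0"
  unfolding lookup_0_eq_peval [of p] lookup_0_eq_peval [of q] lookup_0_eq_peval [of "p * q"]
  by (rule comm_ring_hom.peval_mult [OF comm_ring_hom_id])

lemma lookup_power_0:
  fixes p :: "('v, 'r::comm_ring_1) mpol"
  shows "lookup (p ^ n) 0 = lookup p 0 ^ n"
  by (induction n) (simp_all add: lookup_mult_0)

lemma lookup_sum_mconst_mvar_0: "lookup (\<Sum>a\<in>A. mconst (c a) * mvar (v a)) 0 = 0"
  by (simp add: lookup_sum lookup_mconst_mult)

text \<open>The substituted linear forms have no constant term. This is the base case of
  adjointness, since a constant pairs only with the constant term.\<close>

lemma lookup_peval_csub_0: "lookup (peval mconst (csub I J b) f) 0 = lookup f 0"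
proof (induction f rule: mpol_UNIV_induct)
  case (mvar v q)
  have "lookup (csub I J b v) 0 = 0"
    by (auto simp: csub_def lookup_sum_mconst_mvar_0 split: prod.splits)
  then show ?case by (simp add: mconst.peval_mult lookup_mult_0)
qed (simp_all add: mconst.peval_add lookup_add)

text \<open>Substituting \<open>b X\<close> for a matrix of variables is adjoint to substituting \<open>b\<^sup>T Y\<close>.\<close>

lemma pair_peval_rsub:
  assumes "finite I" "finite J"
  shows "pair f (peval mconst (rsub I J b) p) = pair (peval mconst (csub I J b) f) p"
proof (induction p arbitrary: f rule: mpol_UNIV_induct)
  case (mconst c)
  show ?case by (simp add: lookup_peval_csub_0)
next
  case (mvar v p)
  obtain i j where v: "v = (i, j)" by (cases v)
  show ?case
  proof (cases "i \<in> I \<and> j \<in> J")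
    case True
    \<comment> \<open>Each variable of the linear form moves to the left as a derivative, and the
      chain rule recognises the resulting sum as one derivative after substitution.\<close>
    have "pair f (peval mconst (rsub I J b) (mvar v * p)) =
        (\<Sum>k\<in>J. b i k * pair f (mvar (k, j) * peval mconst (rsub I J b) p))"
      using True by (simp add: v mconst.peval_mult rsub_def sum_distrib_right pair_sum_right
          pair_mconst_mult_right mult.assoc)
    also have "\<dots> = pair (mderiv v (peval mconst (csub I J b) f)) p"
      using True by (simp add: v mderiv_peval_csub [OF assms] pair_sum_left pair_mconst_mult_left
          pair_mvar_mult mvar)
    finally show ?thesis by (simp add: pair_mvar_mult)
  next
    case False
    then show ?thesis
      by (auto simp: v mconst.peval_mult rsub_def pair_mvar_mult mderiv_peval_csub [OF assms])
  qed
next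
  case (add p q)
  then show ?case by (simp add: mconst.peval_add pair_add_right)
qed

section \<open>The Reynolds operator\<close>

text \<open>Over the larger ring each term is a constant times a monomial from the smaller one, and
  both sides are linear in \<open>h\<close>.\<close>

lemma (in comm_ring_hom) pair_adjoint_mmap:
  fixes f f' q :: "('v, 'a) mpol"
  assumes "\<And>h. pair f (q * h) = pair f' h"
  shows "pair (mmap hom f) (mmap hom q * h) = pair (mmap hom f') h"
proof (rule poly_mapping_single_induct [of h UNIV])
  interpret mmap: comm_ring_hom "mmap hom" by (rule comm_ring_hom_mmap)
  fix t :: "'v \<Rightarrow>\<^sub>0 nat" and c :: 'b
  have "Poly_Mapping.single t c = mconst c * mmap hom (Poly_Mapping.single t 1)"
    by (simp add: mmap_single mconst_def mult_single)
  then show "pair (mmap hom f) (mmap hom q * Poly_Mapping.single t c) =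
      pair (mmap hom f') (Poly_Mapping.single t c)"
    by (simp add: mult.left_commute [of _ "mconst c"] pair_mconst_mult_right pair_mmap assms
        flip: mmap.hom_mult)
qed (simp_all add: distrib_left pair_add_right)

lemma (in comm_ring_hom) peval_mmap:
  assumes "comm_ring_hom \<tau>"
  shows "peval \<tau> \<phi> (mmap hom p) = peval (\<lambda>c. \<tau> (hom c)) \<phi> p"
proof -
  interpret t: comm_ring_hom \<tau> by fact
  interpret th: comm_ring_hom "\<lambda>c. \<tau> (hom c)"
    by (rule comm_ring_hom_comp [OF assms comm_ring_hom_axioms])
  show ?thesis
    by (rule peval_unique [where V = UNIV])
      (auto intro: comm_ring_hom_comp [OF t.comm_ring_hom_peval comm_ring_hom_mmap] th.comm_ring_hom_peval)
qed

lemma peval_rsub_gdet: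
  fixes m :: nat
  defines "J \<equiv> {- int m..-1}"
  shows "peval mconst (rsub J J b) (gdet m) =
    mconst (det (mat m m (\<lambda>(r, c). b (int r - int m) (int c - int m)))) * gdet m"
proof -
  have "peval mconst (rsub J J b) (gdet m) =
      det (mat m m (\<lambda>(r, c). \<Sum>k\<in>J. mconst (b (int r - int m) k) * mvar (k, int c - int m)))"
    unfolding mconst.peval_row_det
    by (intro arg_cong [of _ _ det] eq_matI) (auto simp: rsub_def J_def)
  also have "\<dots> = mconst (det (mat m m (\<lambda>(r, c). b (int r - int m) (int c - int m)))) * gdet m"
    unfolding J_def det_sum_prod row_det_def mconst.hom_det [symmetric]
    by (intro arg_cong2 [of _ _ _ _ "(*)"] arg_cong [of _ _ det] eq_matI) auto
  finally show ?thesis .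
qed

lemma csub_eq_rsub: "csub J J b = rsub J J (\<lambda>i k. b k i)"
  by (simp add: csub_def rsub_def)

text \<open>For the \<open>f\<close> that represents \<open>h \<mapsto> \<langle>D\<^sup>e\<^sup>+\<^sup>1, D h\<rangle>\<close> and a generic matrix \<open>G\<close>, adjointness gives
  \<open>f(G X) = det(G)\<^sup>e f(X)\<close> after cancelling \<open>det(G)\<close>; now put \<open>X = 1\<close>.\<close>

lemma cayley:
  fixes m e :: nat
  defines "D \<equiv> (gdet m :: (int \<times> int, 'k::{idom, ring_char_0}) mpol)"
  obtains c where "\<And>h. pair (D ^ Suc e) (D * h) = c * pair (D ^ e) h"
proof -
  define J where "J = {- int m..-1}"
  have J: "finite J" by (simp add: J_def)
  let ?\<iota> = "mmap (mconst :: 'k \<Rightarrow> (int \<times> int, 'k) mpol) :: (int \<times> int, 'k) mpol \<Rightarrow> _"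
  \<comment> \<open>The indices are swapped so that \<open>?C\<close> replaces X by G X, while its
    adjoint \<open>?R\<close> replaces X by G^T X.\<close>
  let ?b = "\<lambda>i k. mvar (k, i) :: (int \<times> int, 'k) mpol"
  let ?R = "peval mconst (rsub J J ?b)" and ?C = "peval mconst (csub J J ?b)"
  interpret \<iota>: comm_ring_hom ?\<iota> by (rule mconst.comm_ring_hom_mmap)
  interpret R: comm_ring_hom ?R by (rule mconst.comm_ring_hom_peval)
  interpret C: comm_ring_hom ?C by (rule mconst.comm_ring_hom_peval)
  obtain f where f: "\<And>h. pair (D ^ Suc e) (D * h) = pair f h"
    using pair_mult_adjoint by blast
  have f': "pair (?\<iota> D ^ Suc e) (?\<iota> D * h) = pair (?\<iota> f) h" for h
    using mconst.pair_adjoint_mmap [OF f, of h] by (simp only: \<iota>.hom_power)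
  have \<iota>D: "?\<iota> D = gdet m"
    by (simp add: D_def mconst.mmap_row_det)
  have CD: "?C (?\<iota> D) = mconst D * ?\<iota> D"
    unfolding \<iota>D csub_eq_rsub unfolding J_def peval_rsub_gdet by (simp add: D_def row_det_def)
  have "det (mat m m (\<lambda>(r, c). ?b (int r - int m) (int c - int m))) = det (transpose_mat (mat m m (\<lambda>(r, c). mvar (int r - int m, int c - int m))))"
    by (intro arg_cong [of _ _ det] eq_matI) auto
  also have "\<dots> = D"
    by (subst det_transpose) (auto simp: D_def row_det_def)
  finally have RD: "?R (?\<iota> D) = mconst D * ?\<iota> D"
    unfolding \<iota>D unfolding J_def peval_rsub_gdet by simp
  have D0: "D \<noteq> 0" by (simp add: D_def)
  \<comment> \<open>\<open>?R\<close> applied to D h yields one factor det(G), and \<open>?C\<close>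
    applied to D^(e+1) yields e + 1 of them; cancelling one leaves det(G)^e.\<close>
  have "?C (?\<iota> f) = mconst (D ^ e) * ?\<iota> f"
  proof (rule pair_eqI)
    fix h
    have "D * pair (?C (?\<iota> f)) h = D * pair (?\<iota> f) (?R h)"
      by (simp add: pair_peval_rsub [OF J J])
    also have "\<dots> = pair (?\<iota> D ^ Suc e) (?R (?\<iota> D * h))"
      by (simp add: R.hom_mult RD mult.assoc pair_mconst_mult_right flip: f')
    also have "\<dots> = pair (mconst (D ^ Suc e) * ?\<iota> D ^ Suc e) (?\<iota> D * h)"
      by (simp only: pair_peval_rsub [OF J J] C.hom_power CD power_mult_distrib mconst.hom_power)
    also have "\<dots> = D ^ Suc e * pair (?\<iota> f) h"
      by (simp only: pair_mconst_mult_left f')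
    also have "\<dots> = D * pair (mconst (D ^ e) * ?\<iota> f) h"
      by (simp only: pair_mconst_mult_left power_Suc mult.assoc)
    finally show "pair (?C (?\<iota> f)) h = pair (mconst (D ^ e) * ?\<iota> f) h"
      using D0 by simp
  qed
  note Cf = this
  \<comment> \<open>Nothing so far restricts the variables of \<open>f\<close>. \<open>z\<close> and
    \<open>z'\<close> erase those outside J x J; the image of \<open>?C\<close> contains none of
    them, so cancelling det(G)^e shows that \<open>f\<close> contains none either.\<close>
  define z where "z = (\<lambda>(i, j). if i \<in> J \<and> j \<in> J then mvar (i, j) else 0 :: (int \<times> int, 'k) mpol)"
  define z' where "z' = (\<lambda>(i, j). if i \<in> J \<and> j \<in> J then mvar (i, j) else 0 :: (int \<times> int, (int \<times> int, 'k) mpol) mpol)"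
  define \<delta> where "\<delta> = (\<lambda>(i, j). if (i::int) = j then 1 else 0 :: (int \<times> int, 'k) mpol)"
  define \<delta>' where "\<delta>' = (\<lambda>(i, j). if (i::int) = j then 1 else 0 :: 'k)"
  let ?Z = "peval mconst z" and ?Z' = "peval mconst z'"
  interpret Z: comm_ring_hom ?Z by (rule mconst.comm_ring_hom_peval)
  interpret Z': comm_ring_hom ?Z' by (rule mconst.comm_ring_hom_peval)
  interpret \<delta>: comm_ring_hom "peval (\<lambda>x. x) \<delta>" by (rule comm_ring_hom.comm_ring_hom_peval [OF comm_ring_hom_id])
  have "?Z' (?C g) = ?C g" for g
  proof (rule peval_unique [where V = UNIV and f = "\<lambda>g. ?Z' (?C g)"])
    show "comm_ring_hom (\<lambda>g. ?Z' (?C g))"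
      by (rule comm_ring_hom_comp [OF Z'.comm_ring_hom_axioms C.comm_ring_hom_axioms])
    show "?Z' (?C (mvar v)) = ?C (mvar v)" for v
    proof -
      have "z' (i, j) = (if i \<in> J \<and> j \<in> J then mvar (i, j) else 0)" for i j
        by (simp add: z'_def)
      then show ?thesis
        by (cases v) (auto simp: csub_def Z'.hom_sum Z'.hom_mult mconst.peval_zero intro!: sum.cong)
    qed
  qed (simp_all add: Z'.comm_ring_hom_axioms C.comm_ring_hom_axioms)
  from this [of "?\<iota> f"] have "mconst (D ^ e) * ?Z' (?\<iota> f) = mconst (D ^ e) * ?\<iota> f"
    by (simp only: Cf Z'.hom_mult mconst.peval_mconst)
  moreover have "mconst (D ^ e) \<noteq> (0 :: (int \<times> int, (int \<times> int, 'k) mpol) mpol)"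
    using D0 by (metis mconst.hom_zero mconst_eq_iff power_not_zero)
  ultimately have "?Z' (?\<iota> f) = ?\<iota> f" by simp
  moreover have "?Z' (?\<iota> g) = ?\<iota> (?Z g)" for g
  proof (rule peval_unique [where V = UNIV and f = "\<lambda>g. ?Z' (?\<iota> g)" and g = "\<lambda>g. ?\<iota> (?Z g)"])
    show "comm_ring_hom (\<lambda>g. ?Z' (?\<iota> g))"
      by (rule comm_ring_hom_comp [OF Z'.comm_ring_hom_axioms \<iota>.comm_ring_hom_axioms])
    show "comm_ring_hom (\<lambda>g. ?\<iota> (?Z g))"
      by (rule comm_ring_hom_comp [OF \<iota>.comm_ring_hom_axioms Z.comm_ring_hom_axioms])
    show "?Z' (?\<iota> (mvar v)) = ?\<iota> (?Z (mvar v))" for v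
      by (cases v) (auto simp: z_def z'_def)
  qed (simp_all add: Z'.comm_ring_hom_axioms \<iota>.comm_ring_hom_axioms Z.comm_ring_hom_axioms)
  ultimately have "?\<iota> f = ?\<iota> (?Z f)" by simp
  then have Zf: "f = ?Z f"
    by (metis mconst.lookup_mmap mconst_eq_iff poly_mapping_eqI)
  \<comment> \<open>At X = 1 the product G X becomes G, so the variables of the coefficient ring
    take over the role of the variables of \<open>g\<close>.\<close>
  have "peval (\<lambda>x. x) \<delta> (?C (?\<iota> g)) = ?Z g" for g
  proof (rule peval_unique [where V = UNIV and f = "\<lambda>g. peval (\<lambda>x. x) \<delta> (?C (?\<iota> g))"])
    show "comm_ring_hom (\<lambda>g. peval (\<lambda>x. x) \<delta> (?C (?\<iota> g)))"
      by (rule comm_ring_hom_comp [OF \<delta>.comm_ring_hom_axioms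
            comm_ring_hom_comp [OF C.comm_ring_hom_axioms \<iota>.comm_ring_hom_axioms]])
    show "peval (\<lambda>x. x) \<delta> (?C (?\<iota> (mvar v))) = ?Z (mvar v)" for v
    proof -
      obtain k l where v: "v = (k, l)" by (cases v)
      have "(\<Sum>i\<in>J. mvar (k, i) * \<delta> (i, l)) = (\<Sum>i\<in>J. if i = l then mvar (k, l) else 0)"
        by (intro sum.cong) (auto simp: \<delta>_def)
      then show ?thesis
        using J by (simp add: v csub_def z_def \<delta>.hom_sum \<delta>.hom_mult comm_ring_hom.peval_zero [OF comm_ring_hom_id]
            comm_ring_hom.peval_mconst [OF comm_ring_hom_id] comm_ring_hom.peval_mvar [OF comm_ring_hom_id])
    qed
  qed (simp_all add: Z.comm_ring_hom_axioms comm_ring_hom.peval_mconst [OF comm_ring_hom_id])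
  from this [of f] have "f = peval (\<lambda>x. x) \<delta> (mconst (D ^ e) * ?\<iota> f)"
    unfolding Cf by (simp only: Zf [symmetric])
  also have "\<dots> = D ^ e * peval (\<lambda>x. x) \<delta> (?\<iota> f)"
    by (simp only: \<delta>.hom_mult comm_ring_hom.peval_mconst [OF comm_ring_hom_id])
  \<comment> \<open>The coefficients of \<open>?\<iota> f\<close> are scalars, so its value at the
    identity matrix is a scalar; this is the constant sought.\<close>
  also have "peval (\<lambda>x. x) \<delta> (?\<iota> f) = mconst (peval (\<lambda>x. x) \<delta>' f)"
  proof (rule peval_unique [where V = UNIV and f = "\<lambda>g. peval (\<lambda>x. x) \<delta> (?\<iota> g)"
        and g = "\<lambda>g. mconst (peval (\<lambda>x. x) \<delta>' g)"])
    show "comm_ring_hom (\<lambda>g. peval (\<lambda>x. x) \<delta> (?\<iota> g))"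
      by (rule comm_ring_hom_comp [OF \<delta>.comm_ring_hom_axioms \<iota>.comm_ring_hom_axioms])
    show "comm_ring_hom (\<lambda>g. mconst (peval (\<lambda>x. x) \<delta>' g))"
      by (rule comm_ring_hom_comp [OF comm_ring_hom_mconst comm_ring_hom.comm_ring_hom_peval [OF comm_ring_hom_id]])
    show "peval (\<lambda>x. x) \<delta> (?\<iota> (mvar v)) = mconst (peval (\<lambda>x. x) \<delta>' (mvar v))" for v
      by (cases v) (auto simp: \<delta>_def \<delta>'_def comm_ring_hom.peval_mvar [OF comm_ring_hom_id])
  qed (simp_all add: comm_ring_hom.peval_mconst [OF comm_ring_hom_id])
  finally have "f = mconst (peval (\<lambda>x. x) \<delta>' f) * D ^ e"
    by (simp add: mult.commute)
  then have "pair f h = peval (\<lambda>x. x) \<delta>' f * pair (D ^ e) h" for h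
    by (metis pair_mconst_mult_left)
  with f that show thesis by metis
qed

text \<open>Positive definiteness makes sense over the integers but not over the given domain.
  Powers of the determinant have integer coefficients, and characteristic 0 keeps the positive
  integer value nonzero.\<close>

lemma pair_self_neq_0:
  fixes m d :: nat
  defines "D \<equiv> (gdet m :: (int \<times> int, 'k::{idom, ring_char_0}) mpol)"
  shows "pair (D ^ d) (D ^ d) \<noteq> 0"
proof -
  have z: "comm_ring_hom (of_int :: int \<Rightarrow> 'k)" by unfold_locales auto
  interpret zm: comm_ring_hom "mmap (of_int :: int \<Rightarrow> 'k)" by (rule comm_ring_hom.comm_ring_hom_mmap [OF z])
  let ?D = "gdet m :: (int \<times> int, int) mpol"
  have pos: "pair f f > 0" if "f \<noteq> 0" for f :: "('v, int) mpol"
    unfolding pair_def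
  proof (rule sum_pos)
    show "keys f \<noteq> {}" using that by simp
    show "0 < of_nat (mfact t) * lookup f t * lookup f t" if "t \<in> keys f" for t
    proof -
      have "mfact t > 0" by (simp add: mfact_def prod_pos)
      moreover have "lookup f t * lookup f t > 0"
        using that by (simp add: in_keys_iff zero_less_mult_iff linorder_neq_iff) linarith
      ultimately show ?thesis by (simp add: mult.assoc)
    qed
  qed simp
  have "D = mmap of_int ?D"
    by (simp add: D_def comm_ring_hom.mmap_row_det [OF z])
  then have "pair (D ^ d) (D ^ d) = of_int (pair (?D ^ d) (?D ^ d))"
    by (simp add: comm_ring_hom.pair_mmap [OF z] flip: zm.hom_power)
  moreover have "?D ^ d \<noteq> 0" by simp
  ultimately show ?thesis
    using pos [of "?D ^ d"] by simp
qed

section \<open>Degrees and the vanishing of pairings with high powers\<close>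

definition mdeg :: "('v \<Rightarrow>\<^sub>0 nat) \<Rightarrow> nat" where
  "mdeg t = (\<Sum>v\<in>keys t. lookup t v)"

lemma mdeg_add: "mdeg (s + t) = mdeg s + mdeg t"
proof -
  have *: "mdeg u = (\<Sum>v\<in>keys s \<union> keys t. lookup u v)" if "keys u \<subseteq> keys s \<union> keys t" for u
    unfolding mdeg_def using that by (intro sum.mono_neutral_left) (auto simp: in_keys_iff)
  show ?thesis
    by (subst (1 2 3) *) (simp_all add: keys_add lookup_add sum.distrib)
qed

text \<open>Each of the d factors contributes a monomial other than 1, hence at least 1 to the
  degree.\<close>

lemma mdeg_keys_power:
  assumes "lookup f 0 = 0" "t \<in> keys (f ^ d)"
  shows "d \<le> mdeg t"
  using assms(2)
proof (induction d arbitrary: t)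
  case (Suc d)
  then obtain s u where su: "t = s + u" "s \<in> keys f" "u \<in> keys (f ^ d)"
    using keys_mult [of f "f ^ d"] by auto
  have "s \<noteq> 0" using su(2) assms(1) by (auto simp: in_keys_iff)
  then obtain v where "v \<in> keys s" by (metis keys_eq_empty ex_in_conv)
  then have "mdeg s \<noteq> 0" by (auto simp: mdeg_def in_keys_iff)
  with Suc.IH [OF su(3)] show ?case by (simp add: su(1) mdeg_add)
qed simp

lemma pair_power_eventually_0:
  assumes "lookup f 0 = 0"
  obtains N where "\<And>d. d \<ge> N \<Longrightarrow> pair (f ^ d) h = 0"
proof -
  \<comment> \<open>One more than every degree occurring in \<open>h\<close>;
    \<open>insert 0\<close> covers \<open>h = 0\<close>.\<close>
  define N where "N = Suc (Max (insert 0 (mdeg ` keys h)))"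
  have "pair (f ^ d) h = 0" if "d \<ge> N" for d
    unfolding pair_def
  proof (rule sum.neutral, rule ballI)
    fix t assume "t \<in> keys (f ^ d)"
    then have "d \<le> mdeg t" by (rule mdeg_keys_power [OF assms])
    then have "t \<notin> keys h"
      using that Max_ge [of "insert 0 (mdeg ` keys h)" "mdeg t"] unfolding N_def by fastforce
    then show "of_nat (mfact t) * lookup (f ^ d) t * lookup h t = 0"
      by (simp add: in_keys_iff)
  qed
  with that show thesis .
qed

lemma pair_1_left [simp]: "pair 1 g = lookup g 0"
  using pair_mconst_left [of 1 g] by (simp add: mconst.hom_one)

text \<open>The constant term is the determinant of the zero matrix. For \<open>m = 0\<close> it
  would be the empty determinant 1.\<close>

lemma lookup_gdet_0:
  assumes "m \<ge> 1"
  shows "lookup (gdet m) 0 = (0::'r::comm_ring_1)"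
proof -
  have "mat m m (\<lambda>(r, c). 0 :: 'r) = 0\<^sub>m m m"
    by (intro eq_matI) auto
  then show ?thesis
    unfolding lookup_0_eq_peval comm_ring_hom.peval_row_det [OF comm_ring_hom_id]
    using assms by simp
qed

text \<open>The cut-off \<open>N\<close> replaces an infinite sum that is finite on each
  \<open>F\<close>. \<open>\<sigma>\<close> carries the inverses, which exist in the field, into the
  coefficient ring.\<close>

definition reynolds :: "nat \<Rightarrow> ('k::field \<Rightarrow> 'r::comm_ring_1) \<Rightarrow> nat \<Rightarrow> (int \<times> int, 'r) mpol \<Rightarrow> 'r" where
  "reynolds m \<sigma> N F = (\<Sum>d\<le>N. \<sigma> (inverse (pair (gdet m ^ d) (gdet m ^ d))) * pair (gdet m ^ d) F)"

lemma reynolds_add: "reynolds m \<sigma> N (F + G) = reynolds m \<sigma> N F + reynolds m \<sigma> N G"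
  by (simp add: reynolds_def pair_add_right distrib_left sum.distrib)

text \<open>A telescoping argument: by Cayley's identity the term d + 1 for D h equals the term d
  for h. The term 0 for D h vanishes because D has no constant term, and \<open>N\<close> is so
  large that the top term for h vanishes too.\<close>

lemma reynolds_det_minus_1:
  fixes \<sigma> :: "'k::field_char_0 \<Rightarrow> 'r::comm_ring_1"
  assumes "comm_ring_hom \<sigma>" "m \<ge> 1"
  obtains N where "reynolds m \<sigma> N ((gdet m - 1) * h) = 0"
proof -
  interpret \<sigma>: comm_ring_hom \<sigma> by fact
  interpret \<sigma>m: comm_ring_hom "mmap \<sigma>" by (rule \<sigma>.comm_ring_hom_mmap)
  let ?D = "gdet m :: (int \<times> int, 'k) mpol" and ?E = "gdet m :: (int \<times> int, 'r) mpol"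
  have E: "?E = mmap \<sigma> ?D" by (simp add: \<sigma>.mmap_row_det)
  define c where "c d = pair (?D ^ d) (?D ^ d)" for d
  have c0: "c d \<noteq> 0" for d
    unfolding c_def by (rule pair_self_neq_0)
  have step: "\<sigma> (inverse (c (Suc d))) * pair (?E ^ Suc d) (?E * h) = \<sigma> (inverse (c d)) * pair (?E ^ d) h" for d
  proof -
    obtain a where a: "\<And>h. pair (?D ^ Suc d) (?D * h) = a * pair (?D ^ d) h"
      using cayley by blast
    \<comment> \<open>Cayley's identity is known over the field; written as an adjointness statement
      it extends to the larger coefficient ring.\<close>
    then have "pair (?D ^ Suc d) (?D * h) = pair (mconst a * ?D ^ d) h" for h
      by (simp only: pair_mconst_mult_left)
    then have "pair (?E ^ Suc d) (?E * h) = \<sigma> a * pair (?E ^ d) h"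
      unfolding E \<sigma>m.hom_power [symmetric]
      by (subst \<sigma>.pair_adjoint_mmap [of "?D ^ Suc d" ?D "mconst a * ?D ^ d"])
        (simp_all add: \<sigma>m.hom_mult pair_mconst_mult_left)
    moreover have "c (Suc d) = a * c d"
      using a [of "?D ^ d"] by (simp add: c_def)
    moreover from this have "inverse (c (Suc d)) * a = inverse (c d)"
      using c0 [of "Suc d"] c0 [of d] by (simp add: field_simps)
    ultimately show ?thesis
      by (metis \<sigma>.hom_mult mult.assoc)
  qed
  obtain N where N: "\<And>d. d \<ge> N \<Longrightarrow> pair (?E ^ d) h = 0"
    using pair_power_eventually_0 lookup_gdet_0 [OF assms(2)] by metis
  have "reynolds m \<sigma> (Suc N) (?E * h) = reynolds m \<sigma> N h"
    unfolding reynolds_def sum.atMost_Suc_shift step [unfolded c_def]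
    by (simp add: lookup_mult_0 lookup_gdet_0 [OF assms(2)])
  also have "\<dots> = reynolds m \<sigma> (Suc N) h"
    by (simp add: reynolds_def N del: power_Suc)
  finally have "reynolds m \<sigma> (Suc N) (?E * h - h) = 0"
    using reynolds_add [of m \<sigma> "Suc N" "?E * h - h" h] by simp
  then show thesis
    by (intro that [of "Suc N"]) (simp add: left_diff_distrib)
qed

text \<open>For d > 0 the power D^d has no constant term, so only d = 0 contributes, with <1, 1> =
  1.\<close>

lemma reynolds_mconst:
  fixes \<sigma> :: "'k::field_char_0 \<Rightarrow> 'r::comm_ring_1"
  assumes "comm_ring_hom \<sigma>" "m \<ge> 1"
  shows "reynolds m \<sigma> N (mconst p) = p"
proof -
  interpret \<sigma>: comm_ring_hom \<sigma> by fact
  have "reynolds m \<sigma> N (mconst p) = (\<Sum>d\<le>N. if d = 0 then p else 0)"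
    unfolding reynolds_def
    by (intro sum.cong) (auto simp: lookup_power_0 lookup_gdet_0 [OF assms(2)] power_0_left)
  then show ?thesis by simp
qed

text \<open>Isolates what the expansion of determinants asks of the target ring, apart from its
  construction as a generated subring. Negatives are covered by the constants.\<close>

definition subalgebra_of_minors :: "nat \<Rightarrow> int set \<Rightarrow> (int \<times> int, 'k::comm_ring_1) mpol set \<Rightarrow> bool" where
  "subalgebra_of_minors m I S \<longleftrightarrow>
     (\<forall>c. mconst c \<in> S) \<and> (\<forall>p\<in>S. \<forall>q\<in>S. p + q \<in> S \<and> p * q \<in> S) \<and>
     (\<forall>l. strict_mono_on {..<m} l \<and> l ` {..<m} \<subseteq> I \<longrightarrow> row_det m l \<in> S)"

section \<open>Polynomials with coefficients in a subalgebra that contains the minors\<close>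

context
  fixes m I and S :: "(int \<times> int, 'k::comm_ring_1) mpol set"
  assumes S: "subalgebra_of_minors m I S"
begin

lemma minors_closed:
  "mconst c \<in> S" "0 \<in> S" "1 \<in> S" "p \<in> S \<Longrightarrow> q \<in> S \<Longrightarrow> p + q \<in> S" "p \<in> S \<Longrightarrow> q \<in> S \<Longrightarrow> p * q \<in> S"
  using S mconst.hom_zero mconst.hom_one unfolding subalgebra_of_minors_def by metis+

lemma minors_sum: "(\<And>a. a \<in> A \<Longrightarrow> f a \<in> S) \<Longrightarrow> sum f A \<in> S"
  by (induction A rule: infinite_finite_induct) (auto intro: minors_closed)

text \<open>A repeated row gives 0, and distinct rows can be sorted at the cost of a scalar.\<close>

lemma minors_row_det:
  assumes "f ` {0..<m} \<subseteq> I"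
  shows "row_det m f \<in> S"
proof (cases "inj_on f {0..<m}")
  case True
  then obtain l and c :: 'k where l: "strict_mono_on {..<m} l" "l ` {..<m} = f ` {..<m}"
    "row_det m f = mconst c * row_det m l"
    by (rule row_det_inj_sort)
  then have "row_det m l \<in> S"
    using S assms by (auto simp: subalgebra_of_minors_def lessThan_atLeast0)
  then show ?thesis by (auto simp: l(3) intro: minors_closed)
next
  case False
  then show ?thesis by (simp add: row_det_not_inj minors_closed)
qed

lemma minors_coeffs_mult:
  assumes "\<forall>t. lookup F t \<in> S" "\<forall>t. lookup G t \<in> S"
  shows "\<forall>t. lookup (F * G) t \<in> S"
proof -
  have "F * G = (\<Sum>s\<in>keys F. Poly_Mapping.single s (lookup F s)) * (\<Sum>u\<in>keys G. Poly_Mapping.single u (lookup G u))"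
    by (simp add: sum_single_lookup)
  also have "\<dots> = (\<Sum>s\<in>keys F. \<Sum>u\<in>keys G. Poly_Mapping.single (s + u) (lookup F s * lookup G u))"
    by (simp add: sum_product mult_single)
  finally show ?thesis
    using assms by (auto simp: lookup_sum lookup_single when_def intro!: minors_sum minors_closed)
qed

lemma minors_coeffs_prod:
  "(\<And>a. a \<in> A \<Longrightarrow> \<forall>t. lookup (f a) t \<in> S) \<Longrightarrow> \<forall>t. lookup (prod f A) t \<in> S"
proof (induction A rule: infinite_finite_induct)
  case (insert a A)
  then show ?case by (simp add: minors_coeffs_mult)
qed (auto simp: lookup_one when_def intro: minors_closed)

text \<open>The Cauchy-Binet expansion before equal terms are collected: every term of det(B^T Y) is
  a product of variables of Y times a determinant of rows of B, possibly repeated or out of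
  order.\<close>

lemma minors_coeffs_csub_gdet:
  assumes "finite I"
  shows "\<forall>t. lookup (peval mconst (csub I {- int m..-1} (\<lambda>i k. mvar (i, k))) (gdet m)) t \<in> S"
proof -
  \<comment> \<open>The row expansion runs over functions on natural numbers, so the rows in
    \<open>I\<close> are numbered by \<open>e\<close>.\<close>
  obtain e :: "nat \<Rightarrow> int" and K where e: "bij_betw e K I" "finite K"
    using ex_bij_betw_nat_finite [OF assms] by auto
  let ?C = "csub I {- int m..-1} (\<lambda>i k. mvar (i, k) :: (int \<times> int, 'k) mpol)"
  let ?a = "\<lambda>i. vec m (\<lambda>k. mconst (mvar (e i, int k - int m) :: (int \<times> int, 'k) mpol)) :: (int \<times> int, (int \<times> int, 'k) mpol) mpol vec"
  let ?x = "\<lambda>l i. mvar (e i, int l - int m)"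
  \<comment> \<open>After transposing, row l is the combination of the rows \<open>?a i\<close> of B
    with coefficients \<open>?x l i\<close>, which suits expansion by rows.\<close>
  have "peval mconst ?C (gdet m) = det (transpose_mat (mat m m (\<lambda>(k, l). ?C (int k - int m, int l - int m))))"
    unfolding mconst.peval_row_det by (subst det_transpose) auto
  also have "transpose_mat (mat m m (\<lambda>(k, l). ?C (int k - int m, int l - int m))) =
      mat\<^sub>r m m (\<lambda>l. finsum_vec TYPE((int \<times> int, (int \<times> int, 'k) mpol) mpol) m (\<lambda>i. ?x l i \<cdot>\<^sub>v ?a i) K)"
    using e(2)
    by (intro eq_matI) (auto simp: csub_def index_finsum_vec mult.commute sum.reindex_bij_betw [OF e(1), symmetric])
  also have "det \<dots> = (\<Sum>f\<in>{f. (\<forall>i\<in>{0..<m}. f i \<in> K) \<and> (\<forall>i. i \<notin> {0..<m} \<longrightarrow> f i = i)}.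
      (\<Prod>l = 0..<m. ?x l (f l)) * det (mat\<^sub>r m m (\<lambda>l. ?a (f l))))"
    by (subst det_linear_rows_sum [OF e(2)]) (auto intro!: sum.cong det_rows_mul)
  finally have eq: "peval mconst ?C (gdet m) = \<dots>" .
  have det: "det (mat\<^sub>r m m (\<lambda>l. ?a (f l))) = mconst (row_det m (\<lambda>l. e (f l)))" for f
    unfolding row_det_def mconst.hom_det [symmetric]
    by (intro arg_cong [of _ _ det] eq_matI) auto
  have var: "\<forall>t. lookup (mvar v :: (int \<times> int, (int \<times> int, 'k) mpol) mpol) t \<in> S" for v
    by (auto simp: mvar_def lookup_single when_def minors_closed)
  have r: "row_det m (\<lambda>l. e (f l)) \<in> S" if "\<forall>i\<in>{0..<m}. f i \<in> K" for f
    using that bij_betwE [OF e(1)] by (intro minors_row_det) auto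
  have c: "\<forall>t. lookup (mconst q :: (int \<times> int, (int \<times> int, 'k) mpol) mpol) t \<in> S" if "q \<in> S" for q
    using that by (auto simp: mconst_def lookup_single when_def minors_closed)
  have "lookup ((\<Prod>l = 0..<m. ?x l (f l)) * mconst (row_det m (\<lambda>l. e (f l)))) t \<in> S"
    if "\<forall>i\<in>{0..<m}. f i \<in> K" for f t
    by (rule spec [OF minors_coeffs_mult [OF minors_coeffs_prod [OF var] c [OF r [OF that]]]])
  then show ?thesis
    unfolding eq det by (auto simp: lookup_sum intro!: minors_sum)
qed

end

text \<open>Invariance is stated as divisibility in k[B][X], which keeps quotient rings out of the
  argument. The Reynolds operator kills the multiple of D - 1 and fixes polynomials free of X, so it
  returns \<open>p\<close>.\<close>

lemma invariant_in_minors: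
  fixes p :: "(int \<times> int, 'k::field_char_0) mpol"
  assumes S: "subalgebra_of_minors m I S" and "finite I" "m \<ge> 1"
    and inv: "(gdet m - 1) dvd (peval (\<lambda>c. mconst (mconst c)) (rsub I {- int m..-1} (\<lambda>i k. mvar (i, k))) p - mconst p)"
  shows "p \<in> S"
proof -
  let ?J = "{- int m..-1}"
  let ?R = "rsub I ?J (\<lambda>i k. mvar (i, k) :: (int \<times> int, 'k) mpol)"
  let ?C = "csub I ?J (\<lambda>i k. mvar (i, k) :: (int \<times> int, 'k) mpol)"
  interpret C: comm_ring_hom "peval mconst ?C" by (rule mconst.comm_ring_hom_peval)
  note mconst_hom = comm_ring_hom_mconst [where 'a = 'k]
  obtain h where h: "peval (\<lambda>c. mconst (mconst c)) ?R p = mconst p + (gdet m - 1) * h"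
    using inv by (auto simp: dvd_def algebra_simps)
  obtain N where "reynolds m mconst N ((gdet m - 1) * h) = 0"
    using reynolds_det_minus_1 [OF comm_ring_hom_mconst assms(3)] by blast
  then have "p = reynolds m mconst N (peval (\<lambda>c. mconst (mconst c)) ?R p)"
    by (simp add: h reynolds_add reynolds_mconst [OF comm_ring_hom_mconst assms(3)])
  \<comment> \<open>Splitting off the extension of scalars leaves a substitution over k[B], to which
    adjointness applies. The coefficients of \<open>mmap mconst p\<close> are scalars, so only those
    of det(B^T Y)^d matter.\<close>
  also have "peval (\<lambda>c. mconst (mconst c)) ?R p = peval mconst ?R (mmap mconst p)"
    by (simp add: mconst.peval_mmap [OF comm_ring_hom_mconst])
  finally have p: "p = (\<Sum>d\<le>N. mconst (inverse (pair (gdet m ^ d) (gdet m ^ d))) *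
      pair (peval mconst ?C (gdet m) ^ d) (mmap mconst p))"
    by (simp only: reynolds_def pair_peval_rsub [OF assms(2) finite_atLeastAtMost_int] C.hom_power)
  have "\<forall>t. lookup (peval mconst ?C (gdet m) ^ d) t \<in> S" for d
    using minors_coeffs_prod [OF S minors_coeffs_csub_gdet [OF S assms(2)], where A = "{..<d}"]
    by simp
  moreover have "of_nat n \<in> S" for n
    using minors_closed(1) [OF S, of "of_nat n"] by (simp add: mconst.hom_of_nat)
  ultimately show ?thesis
    by (subst p) (auto simp: pair_def mconst.lookup_mmap intro!: minors_sum [OF S] minors_closed [OF S])
qed

section \<open>Algebras as records\<close>

text \<open>The scalars form a type rather than a carrier. The laws of the action are reduced to
  those of the map that sends \<open>c\<close> to \<open>c \<odot> \<one>\<close>, which leaves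
  little to check for quotients and free algebras.\<close>

locale kalg = cring A for A :: "('k::comm_ring_1, 'a) module" (structure) +
  assumes smult_one_closed [simp]: "c \<odot> \<one> \<in> carrier A"
    and smult_eq: "x \<in> carrier A \<Longrightarrow> c \<odot> x = (c \<odot> \<one>) \<otimes> x"
    and smult_one_add: "(c + d) \<odot> \<one> = c \<odot> \<one> \<oplus> d \<odot> \<one>"
    and smult_one_mult: "(c * d) \<odot> \<one> = (c \<odot> \<one>) \<otimes> (d \<odot> \<one>)"
    and one_smult_one [simp]: "1 \<odot> \<one> = \<one>"
begin

lemma smult_closed [simp]: "x \<in> carrier A \<Longrightarrow> c \<odot> x \<in> carrier A"
  by (simp add: smult_eq [of x])

lemma zero_smult_one [simp]: "0 \<odot> \<one> = \<zero>"
proof -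
  have "0 \<odot> \<one> \<oplus> 0 \<odot> \<one> = 0 \<odot> \<one>"
    by (simp flip: smult_one_add)
  then show ?thesis by (simp add: add.l_cancel_one)
qed

lemma zero_smult [simp]: "x \<in> carrier A \<Longrightarrow> 0 \<odot> x = \<zero>"
  by (simp add: smult_eq [of x])

lemma one_smult [simp]: "x \<in> carrier A \<Longrightarrow> 1 \<odot> x = x"
  by (simp add: smult_eq [of x])

lemma smult_add: "x \<in> carrier A \<Longrightarrow> (c + d) \<odot> x = c \<odot> x \<oplus> d \<odot> x"
  by (simp add: smult_eq [of x] smult_one_add l_distr)

lemma smult_mult_smult:
  assumes "x \<in> carrier A" "y \<in> carrier A"
  shows "(c * d) \<odot> (x \<otimes> y) = (c \<odot> x) \<otimes> (d \<odot> y)"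
  using assms by (simp add: smult_eq [of x] smult_eq [of y] smult_eq [of "x \<otimes> y"] smult_one_mult m_ac)

section \<open>Evaluation of polynomials in a record algebra\<close>

context
  fixes \<phi> :: "'v \<Rightarrow> 'a" and V
  assumes \<phi>: "\<phi> \<in> V \<rightarrow> carrier A"
begin

definition moneval :: "('v \<Rightarrow>\<^sub>0 nat) \<Rightarrow> 'a" where
  "moneval t = (\<Otimes>v\<in>keys t. \<phi> v [^] lookup t v)"

lemma moneval_superset:
  assumes "finite W" "keys t \<subseteq> W" "W \<subseteq> V"
  shows "moneval t = (\<Otimes>v\<in>W. \<phi> v [^] lookup t v)"
  unfolding moneval_def using assms \<phi>
  by (intro finprod_mono_neutral_cong_left) (auto simp: in_keys_iff)

lemma moneval_closed: "keys t \<subseteq> V \<Longrightarrow> moneval t \<in> carrier A"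
  unfolding moneval_def using \<phi> by (intro finprod_closed) auto

lemma moneval_add:
  assumes "keys s \<subseteq> V" "keys t \<subseteq> V"
  shows "moneval (s + t) = moneval s \<otimes> moneval t"
proof -
  let ?W = "keys s \<union> keys t"
  have *: "moneval u = (\<Otimes>v\<in>?W. \<phi> v [^] lookup u v)" if "keys u \<subseteq> ?W" for u
    using that assms by (intro moneval_superset) auto
  have \<phi>W: "\<And>v. v \<in> ?W \<Longrightarrow> \<phi> v \<in> carrier A" using \<phi> assms by auto
  have "moneval (s + t) = (\<Otimes>v\<in>?W. \<phi> v [^] lookup s v \<otimes> \<phi> v [^] lookup t v)"
    unfolding *[OF keys_add] using \<phi>W
    by (intro finprod_cong) (auto simp: lookup_add nat_pow_mult)
  also have "\<dots> = moneval s \<otimes> moneval t"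
    unfolding *[OF Un_upper1] *[OF Un_upper2] using \<phi>W
    by (intro finprod_multf) auto
  finally show ?thesis .
qed

lemma alg_eval_superset:
  assumes "finite T" "keys p \<subseteq> T" "\<And>t. t \<in> T \<Longrightarrow> keys t \<subseteq> V"
  shows "alg_eval A \<phi> p = (\<Oplus>t\<in>T. lookup p t \<odot> moneval t)"
  unfolding alg_eval_def moneval_def [symmetric] using assms
  by (intro add.finprod_mono_neutral_cong_left) (auto simp: in_keys_iff moneval_closed)

lemma alg_eval_closed: "p \<in> carrier (poly_alg V) \<Longrightarrow> alg_eval A \<phi> p \<in> carrier A"
  unfolding alg_eval_def moneval_def [symmetric]
  by (intro finsum_closed) (auto simp: poly_alg_def moneval_closed)

lemma alg_eval_add:
  assumes "p \<in> carrier (poly_alg V)" "q \<in> carrier (poly_alg V)"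
  shows "alg_eval A \<phi> (p + q) = alg_eval A \<phi> p \<oplus> alg_eval A \<phi> q"
proof -
  let ?T = "keys p \<union> keys q"
  have T: "\<And>t. t \<in> ?T \<Longrightarrow> keys t \<subseteq> V" using assms by (auto simp: poly_alg_def)
  have *: "alg_eval A \<phi> r = (\<Oplus>t\<in>?T. lookup r t \<odot> moneval t)" if "keys r \<subseteq> ?T" for r
    using that T by (intro alg_eval_superset) auto
  have "alg_eval A \<phi> (p + q) = (\<Oplus>t\<in>?T. lookup p t \<odot> moneval t \<oplus> lookup q t \<odot> moneval t)"
    unfolding *[OF keys_add] using T
    by (intro finsum_cong) (auto simp: lookup_add smult_add moneval_closed simp_implies_def)
  also have "\<dots> = alg_eval A \<phi> p \<oplus> alg_eval A \<phi> q"
    unfolding *[OF Un_upper1] *[OF Un_upper2] using T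
    by (intro finsum_addf) (auto simp: moneval_closed)
  finally show ?thesis .
qed

lemma alg_eval_single:
  assumes "keys t \<subseteq> V"
  shows "alg_eval A \<phi> (Poly_Mapping.single t c) = c \<odot> moneval t"
  using assms by (subst alg_eval_superset [of "{t}"]) (auto simp: moneval_closed)

lemma alg_eval_mconst [simp]: "alg_eval A \<phi> (mconst c) = c \<odot> \<one>"
  by (simp add: mconst_def alg_eval_single moneval_def)

lemma alg_eval_mvar [simp]: "v \<in> V \<Longrightarrow> alg_eval A \<phi> (mvar v) = \<phi> v"
  using \<phi> by (subst mvar_def, subst alg_eval_single) (auto simp: moneval_def Pi_iff)

text \<open>Both sides are additive in each factor, so monomials suffice. Membership in the carrier
  accompanies the induction because the record operations obey the ring laws only there.\<close>

lemma alg_eval_mult: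
  assumes "p \<in> carrier (poly_alg V)" "q \<in> carrier (poly_alg V)"
  shows "alg_eval A \<phi> (p * q) = alg_eval A \<phi> p \<otimes> alg_eval A \<phi> q"
proof -
  let ?K = "{t. keys t \<subseteq> V}"
  have pa: "r \<in> carrier (poly_alg V) \<longleftrightarrow> keys r \<subseteq> ?K" for r :: "('v, 'k) mpol"
    by (auto simp: poly_alg_def)
  have mult_closed: "keys (r * s) \<subseteq> ?K" if "keys r \<subseteq> ?K" "keys s \<subseteq> ?K" for r s :: "('v, 'k) mpol"
  proof -
    have "keys (a + b) \<subseteq> V" if "a \<in> keys r" "b \<in> keys s" for a b
      using keys_add [of a b] that \<open>keys r \<subseteq> ?K\<close> \<open>keys s \<subseteq> ?K\<close> by blast
    then show ?thesis using keys_mult [of r s] by blast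
  qed
  have mult_monom: "alg_eval A \<phi> (Poly_Mapping.single s c * q) = alg_eval A \<phi> (Poly_Mapping.single s c) \<otimes> alg_eval A \<phi> q"
    if s: "s \<in> ?K" and "keys q \<subseteq> ?K" for s c and q :: "('v, 'k) mpol"
    using that(2)
  proof (induction q rule: poly_mapping_single_induct)
    case (single t d)
    have "keys (s + t) \<subseteq> V" using s single keys_add [of s t] by auto
    then show ?case
      using s single by (simp add: mult_single alg_eval_single moneval_add smult_mult_smult moneval_closed)
  next
    case (add q r)
    then show ?case
      using s by (simp add: distrib_left alg_eval_add alg_eval_closed pa mult_closed r_distr)
  next
    case zero
    have "alg_eval A \<phi> 0 = \<zero>" by (simp add: alg_eval_def)
    then show ?case using s by (simp add: alg_eval_closed pa)
  qed
  have "keys p \<subseteq> ?K" using assms by (simp add: pa)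
  then show ?thesis
  proof (induction p rule: poly_mapping_single_induct)
    case (single t c)
    then show ?case using assms by (intro mult_monom) (auto simp: pa)
  next
    case (add p r)
    then show ?case
      using assms by (simp add: distrib_right alg_eval_add alg_eval_closed pa mult_closed l_distr)
  next
    case zero
    have "alg_eval A \<phi> 0 = \<zero>" by (simp add: alg_eval_def)
    then show ?case using assms by (simp add: alg_eval_closed)
  qed
qed

lemma alg_eval_hom: "alg_eval A \<phi> \<in> Ring.ring_hom (poly_alg V) A"
  using alg_eval_mconst [of 1] alg_eval_closed alg_eval_mult alg_eval_add
  by (intro ring_hom_memI) (auto simp: poly_alg_def mconst.hom_one simp del: alg_eval_mconst)

end

end

section \<open>The polynomial ring as a record algebra\<close>

lemma poly_alg_simps [simp]:
  "x \<otimes>\<^bsub>poly_alg V\<^esub> y = x * y" "x \<oplus>\<^bsub>poly_alg V\<^esub> y = x + y" "\<one>\<^bsub>poly_alg V\<^esub> = 1" "\<zero>\<^bsub>poly_alg V\<^esub> = 0"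
  "c \<odot>\<^bsub>poly_alg V\<^esub> x = mconst c * x"
  by (simp_all add: poly_alg_def mconst_def)

lemma poly_alg_closed [simp, intro]:
  "mconst c \<in> carrier (poly_alg V)" "0 \<in> carrier (poly_alg V)" "1 \<in> carrier (poly_alg V)"
  "p \<in> carrier (poly_alg V) \<Longrightarrow> q \<in> carrier (poly_alg V) \<Longrightarrow> p + q \<in> carrier (poly_alg V)"
  "p \<in> carrier (poly_alg V) \<Longrightarrow> q \<in> carrier (poly_alg V) \<Longrightarrow> p * q \<in> carrier (poly_alg V)"
  "p \<in> carrier (poly_alg V) \<Longrightarrow> - p \<in> carrier (poly_alg V)"
  "v \<in> V \<Longrightarrow> mvar v \<in> carrier (poly_alg V)"
proof -
  show "p + q \<in> carrier (poly_alg V)" if "p \<in> carrier (poly_alg V)" "q \<in> carrier (poly_alg V)" for p q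
    using that keys_add [of p q] unfolding poly_alg_def by auto
  show "p * q \<in> carrier (poly_alg V)" if "p \<in> carrier (poly_alg V)" "q \<in> carrier (poly_alg V)" for p q
  proof -
    have "keys (a + b) \<subseteq> V" if "a \<in> keys p" "b \<in> keys q" for a b
      using keys_add [of a b] that \<open>p \<in> _\<close> \<open>q \<in> _\<close> unfolding poly_alg_def by fastforce
    then show ?thesis using keys_mult [of p q] unfolding poly_alg_def by fastforce
  qed
qed (auto simp: poly_alg_def mconst_def mvar_def)

lemma poly_alg_sum:
  "(\<And>a. a \<in> A \<Longrightarrow> f a \<in> carrier (poly_alg V)) \<Longrightarrow> sum f A \<in> carrier (poly_alg V)"
  by (induction A rule: infinite_finite_induct) auto

lemma poly_alg_prod:
  "(\<And>a. a \<in> A \<Longrightarrow> f a \<in> carrier (poly_alg V)) \<Longrightarrow> prod f A \<in> carrier (poly_alg V)"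
  by (induction A rule: infinite_finite_induct) auto

lemma kalg_poly_alg: "kalg (poly_alg V :: ('k::comm_ring_1, ('v, 'k) mpol) module)"
proof -
  have "\<exists>y\<in>carrier (poly_alg V). y + x = 0" if "x \<in> carrier (poly_alg V)" for x :: "('v, 'k) mpol"
    using that by (intro bexI [of _ "- x"]) auto
  then have "cring (poly_alg V :: ('k, ('v, 'k) mpol) module)"
    by (intro cringI abelian_groupI comm_monoidI) (auto simp: algebra_simps)
  then show ?thesis
    by (intro kalg.intro kalg_axioms.intro) (auto simp: mconst.hom_add mconst.hom_mult mconst.hom_one)
qed

lemma row_det_closed:
  assumes "l ` {..<m} \<subseteq> I" "{- int m..-1} \<subseteq> J"
  shows "row_det m l \<in> carrier (poly_alg (I \<times> J))"
proof -
  have var: "mat m m (\<lambda>(r, c). mvar (l r, int c - int m)) $$ (i, p i) \<in> carrier (poly_alg (I \<times> J))"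
    if "p permutes {0..<m}" "i < m" for p i
  proof -
    have "p i < m" using permutes_in_image [OF that(1), of i] that(2) by simp
    then have "(l i, int (p i) - int m) \<in> I \<times> J" using that(2) assms by auto
    then show ?thesis using that(2) \<open>p i < m\<close> by (simp add: poly_alg_closed(7))
  qed
  have sign: "(signof p :: (int \<times> int, 'a) mpol) \<in> carrier (poly_alg (I \<times> J))" for p :: "nat \<Rightarrow> nat"
    by (auto simp: sign_def)
  show ?thesis
    unfolding row_det_def det_def
    using var sign by (auto intro!: poly_alg_sum poly_alg_prod poly_alg_closed simp del: index_mat)
qed

lemma ring_hom_poly_alg_eqI:
  assumes "f \<in> Ring.ring_hom (poly_alg V) A" "g \<in> Ring.ring_hom (poly_alg V) A" "p \<in> carrier (poly_alg V)"
    and "\<And>c. f (mconst c) = g (mconst c)" "\<And>v. v \<in> V \<Longrightarrow> f (mvar v) = g (mvar v)"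
  shows "f p = g p"
  using assms(3)
proof (induction p rule: mpol_mvar_induct)
  case (mvar v q)
  then show ?case
    using ring_hom_mult [OF assms(1), of "mvar v" q] ring_hom_mult [OF assms(2), of "mvar v" q] assms(5)
    by auto
next
  case (add p q)
  then show ?case
    using ring_hom_add [OF assms(1), of p q] ring_hom_add [OF assms(2), of p q] by auto
qed (rule assms(4))

subsection \<open>Quotients\<close>

lemma quot_alg_simps:
  "carrier (quot_alg A I) = carrier (A Quot I)" "monoid.mult (quot_alg A I) = monoid.mult (A Quot I)"
  "one (quot_alg A I) = one (A Quot I)" "zero (quot_alg A I) = zero (A Quot I)"
  "add (quot_alg A I) = add (A Quot I)"
  "module.smult (quot_alg A I) = (\<lambda>c X. \<Union>x\<in>X. I +>\<^bsub>A\<^esub> (c \<odot>\<^bsub>A\<^esub> x))"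
  by (simp_all add: quot_alg_def ring.defs module.defs)

lemma quot_alg_carrier: "carrier (quot_alg A I) = (\<lambda>x. I +>\<^bsub>A\<^esub> x) ` carrier A"
  by (auto simp: quot_alg_simps FactRing_simps)

locale kalg_ideal = kalg A + ideal I A for A :: "('k::comm_ring_1, 'a) module" (structure) and I
begin

text \<open>The operations are those of \<open>A Quot I\<close>, but the record is extended by a
  scalar action, so the ring laws are transported one by one.\<close>

lemma cring_quot_alg: "cring (quot_alg A I)"
proof -
  interpret Q: cring "A Quot I" by (rule quotient_is_cring) (rule is_cring)
  have "\<exists>y\<in>carrier (A Quot I). y \<oplus>\<^bsub>A Quot I\<^esub> x = \<zero>\<^bsub>A Quot I\<^esub>" if "x \<in> carrier (A Quot I)" for x
    using that by (intro bexI [of _ "\<ominus>\<^bsub>A Quot I\<^esub> x"]) (auto simp: Q.l_neg)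
  note inverse = this
  show ?thesis
  proof (intro cringI abelian_groupI comm_monoidI)
    fix x y z
    assume "x \<in> carrier (quot_alg A I)" "y \<in> carrier (quot_alg A I)" "z \<in> carrier (quot_alg A I)"
    then show "(x \<oplus>\<^bsub>quot_alg A I\<^esub> y) \<otimes>\<^bsub>quot_alg A I\<^esub> z =
        x \<otimes>\<^bsub>quot_alg A I\<^esub> z \<oplus>\<^bsub>quot_alg A I\<^esub> y \<otimes>\<^bsub>quot_alg A I\<^esub> z"
      by (simp add: quot_alg_simps Q.l_distr)
  qed (simp_all add: quot_alg_simps Q.m_ac Q.a_ac inverse)
qed

lemma coset_hom: "(\<lambda>x. I +> x) \<in> Ring.ring_hom A (quot_alg A I)"
  using rcos_ring_hom by (auto simp: Ring.ring_hom_def quot_alg_simps)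

text \<open>The action on a coset is a union over its representatives. All members of this union
  coincide, because scaling amounts to multiplication by the coset of
  \<open>c \<odot> \<one>\<close>.\<close>

lemma smult_coset:
  assumes "x \<in> carrier A"
  shows "c \<odot>\<^bsub>quot_alg A I\<^esub> (I +> x) = I +> (c \<odot> x)"
proof -
  have "I +> (c \<odot> y) = I +> (c \<odot> x)" if "y \<in> I +> x" for y
  proof -
    have y: "y \<in> carrier A" using that assms a_r_coset_subset_G a_subset by blast
    have "I +> y = I +> x"
      using that assms a_repr_independence' by metis
    then have "(I +> (c \<odot> \<one>)) \<otimes>\<^bsub>quot_alg A I\<^esub> (I +> y) = (I +> (c \<odot> \<one>)) \<otimes>\<^bsub>quot_alg A I\<^esub> (I +> x)"
      by simp
    then show ?thesis
      unfolding smult_eq [OF assms] smult_eq [OF y]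
      by (simp only: ring_hom_mult [OF coset_hom smult_one_closed assms] ring_hom_mult [OF coset_hom smult_one_closed y])
  qed
  note coset = this
  have "I +> x \<noteq> {}" using a_rcos_self [OF assms] by blast
  then show ?thesis
    unfolding quot_alg_simps by (rule SUP_eq_const) (rule coset)
qed

lemma kalg_quot_alg: "kalg (quot_alg A I)"
proof -
  have one: "\<one>\<^bsub>quot_alg A I\<^esub> = I +> \<one>"
    using ring_hom_one [OF coset_hom] by simp
  show ?thesis
  proof (intro kalg.intro kalg_axioms.intro cring_quot_alg)
    fix X c assume "X \<in> carrier (quot_alg A I)"
    then obtain x where x: "x \<in> carrier A" "X = I +> x" by (auto simp: quot_alg_carrier)
    have "I +> (c \<odot> x) = (I +> (c \<odot> \<one>)) \<otimes>\<^bsub>quot_alg A I\<^esub> (I +> x)"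
      unfolding smult_eq [OF x(1)] by (rule ring_hom_mult [OF coset_hom smult_one_closed x(1)])
    then show "c \<odot>\<^bsub>quot_alg A I\<^esub> X = (c \<odot>\<^bsub>quot_alg A I\<^esub> \<one>\<^bsub>quot_alg A I\<^esub>) \<otimes>\<^bsub>quot_alg A I\<^esub> X"
      using x by (simp add: one smult_coset)
  qed (simp_all add: one smult_coset smult_one_add smult_one_mult ring_hom_mult [OF coset_hom]
      ring_hom_add [OF coset_hom] ring_hom_closed [OF coset_hom])
qed

lemma coset_eq_iff:
  "x \<in> carrier A \<Longrightarrow> y \<in> carrier A \<Longrightarrow> I +> x = I +> y \<longleftrightarrow> x \<ominus> y \<in> I"
  using quotient_eq_iff_same_a_r_cos [OF is_ideal, of x y] by blast

end

subsection \<open>The free algebra on pairs\<close>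

text \<open>Bilinear extension of an operation on basis elements. The usual product of finitely
  supported maps adds keys, whereas here pairs have to be multiplied.\<close>

definition pconv :: "('p \<Rightarrow> 'p \<Rightarrow> 'p) \<Rightarrow> ('p \<Rightarrow>\<^sub>0 'k::comm_ring_1) \<Rightarrow> ('p \<Rightarrow>\<^sub>0 'k) \<Rightarrow> ('p \<Rightarrow>\<^sub>0 'k)" where
  "pconv f p q = (\<Sum>x\<in>keys p. \<Sum>y\<in>keys q. Poly_Mapping.single (f x y) (lookup p x * lookup q y))"

lemma pconv_superset:
  assumes "finite S" "finite T" "keys p \<subseteq> S" "keys q \<subseteq> T"
  shows "pconv f p q = (\<Sum>x\<in>S. \<Sum>y\<in>T. Poly_Mapping.single (f x y) (lookup p x * lookup q y))"
proof -
  have "(\<Sum>y\<in>keys q. Poly_Mapping.single (f x y) (lookup p x * lookup q y)) =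
      (\<Sum>y\<in>T. Poly_Mapping.single (f x y) (lookup p x * lookup q y))" for x
    using assms by (intro sum.mono_neutral_left) (auto simp: in_keys_iff)
  then show ?thesis
    unfolding pconv_def using assms
    by (simp, intro sum.mono_neutral_left) (auto simp: in_keys_iff)
qed

lemma pconv_add_left: "pconv f (p + p') q = pconv f p q + pconv f p' q"
proof -
  have "keys (p + p') \<subseteq> keys p \<union> keys p'" by (rule keys_add)
  then show ?thesis
    by (simp add: pconv_superset [of "keys p \<union> keys p'" "keys q"] lookup_add distrib_right single_add sum.distrib)
qed

lemma pconv_add_right: "pconv f p (q + q') = pconv f p q + pconv f p q'"
proof -
  have "keys (q + q') \<subseteq> keys q \<union> keys q'" by (rule keys_add)
  then show ?thesis
    by (simp add: pconv_superset [of "keys p" "keys q \<union> keys q'"] lookup_add distrib_left single_add sum.distrib)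
qed

lemma pconv_zero [simp]: "pconv f 0 q = 0" "pconv f p 0 = 0"
  by (simp_all add: pconv_def)

lemma pconv_single:
  "pconv f (Poly_Mapping.single x c) (Poly_Mapping.single y d) = Poly_Mapping.single (f x y) (c * d)"
  by (subst pconv_superset [of "{x}" "{y}"]) auto

text \<open>Double induction for any predicate stable under addition in each argument; besides
  equations it serves supports and congruences.\<close>

lemma pconv_bilinear_eqI:
  assumes "keys p \<subseteq> K" "keys q \<subseteq> L"
    and "\<And>x c y d. x \<in> K \<Longrightarrow> y \<in> L \<Longrightarrow> P (Poly_Mapping.single x c) (Poly_Mapping.single y d)"
    and "\<And>p p' q. keys p \<subseteq> K \<Longrightarrow> keys p' \<subseteq> K \<Longrightarrow> keys q \<subseteq> L \<Longrightarrow> P p q \<Longrightarrow> P p' q \<Longrightarrow> P (p + p') q"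
    and "\<And>p q q'. keys p \<subseteq> K \<Longrightarrow> keys q \<subseteq> L \<Longrightarrow> keys q' \<subseteq> L \<Longrightarrow> P p q \<Longrightarrow> P p q' \<Longrightarrow> P p (q + q')"
    and "\<And>q. P 0 q" "\<And>p. P p 0"
  shows "P (p :: 'a \<Rightarrow>\<^sub>0 'b::comm_monoid_add) (q :: 'c \<Rightarrow>\<^sub>0 'd::comm_monoid_add)"
  using assms(1)
proof (induction p rule: poly_mapping_single_induct)
  case (single x c)
  have sx: "keys (Poly_Mapping.single x c) \<subseteq> K" using single by simp
  from assms(2) show ?case
  proof (induction q rule: poly_mapping_single_induct)
    case (single y d)
    then show ?case using \<open>x \<in> K\<close> by (intro assms(3))
  next
    case (add p q)
    then show ?case using sx by (intro assms(5)) auto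
  qed (rule assms(7))
next
  case (add p q)
  then show ?case using assms(2) by (intro assms(4)) auto
qed (rule assms(6))

lemma pconv_keys:
  assumes "keys p \<subseteq> K" "keys q \<subseteq> L" "\<And>x y. x \<in> K \<Longrightarrow> y \<in> L \<Longrightarrow> f x y \<in> M"
  shows "keys (pconv f p q) \<subseteq> M"
  using assms(1,2)
proof (rule pconv_bilinear_eqI [where P = "\<lambda>p q. keys (pconv f p q) \<subseteq> M"])
  show "keys (pconv f (p + p') q) \<subseteq> M" if "keys (pconv f p q) \<subseteq> M" "keys (pconv f p' q) \<subseteq> M" for p p' q
    using that keys_add [of "pconv f p q" "pconv f p' q"] by (auto simp: pconv_add_left)
  show "keys (pconv f p (q + q')) \<subseteq> M" if "keys (pconv f p q) \<subseteq> M" "keys (pconv f p q') \<subseteq> M" for p q q'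
    using that keys_add [of "pconv f p q" "pconv f p q'"] by (auto simp: pconv_add_right)
qed (auto simp: pconv_single assms(3))

locale kalg_pair = A: kalg A + B: kalg B
  for A :: "('k::comm_ring_1, 'a) module" and B :: "('k, 'b) module"
begin

abbreviation "F \<equiv> free_pair_alg A B"
abbreviation "pm \<equiv> \<lambda>x y. (fst x \<otimes>\<^bsub>A\<^esub> fst y, snd x \<otimes>\<^bsub>B\<^esub> snd y)"

lemma free_pair_simps:
  "carrier F = {p. keys p \<subseteq> carrier A \<times> carrier B}" "p \<otimes>\<^bsub>F\<^esub> q = pconv pm p q"
  "\<one>\<^bsub>F\<^esub> = Poly_Mapping.single (\<one>\<^bsub>A\<^esub>, \<one>\<^bsub>B\<^esub>) 1" "\<zero>\<^bsub>F\<^esub> = 0" "p \<oplus>\<^bsub>F\<^esub> q = p + q"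
  "c \<odot>\<^bsub>F\<^esub> p = Poly_Mapping.map ((*) c) p"
  by (simp_all add: free_pair_alg_def pconv_def)

text \<open>\<open>F\<close> is the monoid algebra of the commutative monoid of pairs under
  multiplication, so the multiplicative laws reduce to basis pairs.\<close>

lemma cring_free_pair: "cring F"
proof (intro cringI abelian_groupI comm_monoidI)
  fix x y z
  let ?K = "carrier A \<times> carrier B"
  assume x: "x \<in> carrier F"
  show "\<zero>\<^bsub>F\<^esub> \<oplus>\<^bsub>F\<^esub> x = x" by (simp add: free_pair_simps)
  show "\<exists>y\<in>carrier F. y \<oplus>\<^bsub>F\<^esub> x = \<zero>\<^bsub>F\<^esub>"
    using x by (intro bexI [of _ "- x"]) (auto simp: free_pair_simps)
  show "\<one>\<^bsub>F\<^esub> \<otimes>\<^bsub>F\<^esub> x = x"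
  proof -
    have "keys x \<subseteq> ?K" using x by (simp add: free_pair_simps)
    then show ?thesis
      unfolding free_pair_simps
      by (induction x rule: poly_mapping_single_induct) (auto simp: pconv_add_right pconv_single)
  qed
  assume y: "y \<in> carrier F"
  show "x \<oplus>\<^bsub>F\<^esub> y \<in> carrier F" "x \<oplus>\<^bsub>F\<^esub> y = y \<oplus>\<^bsub>F\<^esub> x"
    using x y keys_add [of x y] by (auto simp: free_pair_simps add.commute)
  show "x \<otimes>\<^bsub>F\<^esub> y \<in> carrier F"
    using x y pconv_keys [of x ?K y ?K pm ?K] by (auto simp: free_pair_simps)
  have xy: "keys x \<subseteq> ?K" "keys y \<subseteq> ?K" using x y by (auto simp: free_pair_simps)
  show "x \<otimes>\<^bsub>F\<^esub> y = y \<otimes>\<^bsub>F\<^esub> x"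
    unfolding free_pair_simps using xy
    by (rule pconv_bilinear_eqI [where P = "\<lambda>x y. pconv pm x y = pconv pm y x"])
      (auto simp: pconv_add_left pconv_add_right pconv_single A.m_comm B.m_comm mult.commute)
  assume z: "z \<in> carrier F"
  show "x \<oplus>\<^bsub>F\<^esub> y \<oplus>\<^bsub>F\<^esub> z = x \<oplus>\<^bsub>F\<^esub> (y \<oplus>\<^bsub>F\<^esub> z)" by (simp add: free_pair_simps add.assoc)
  show "(x \<oplus>\<^bsub>F\<^esub> y) \<otimes>\<^bsub>F\<^esub> z = x \<otimes>\<^bsub>F\<^esub> z \<oplus>\<^bsub>F\<^esub> y \<otimes>\<^bsub>F\<^esub> z"
    by (simp add: free_pair_simps pconv_add_left)
  have kz: "keys z \<subseteq> ?K" using z by (simp add: free_pair_simps)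
  then show "x \<otimes>\<^bsub>F\<^esub> y \<otimes>\<^bsub>F\<^esub> z = x \<otimes>\<^bsub>F\<^esub> (y \<otimes>\<^bsub>F\<^esub> z)"
    unfolding free_pair_simps
  proof (induction z rule: poly_mapping_single_induct)
    \<comment> \<open>Associativity is trilinear: once the third factor is a basis element, the rule
      for two arguments handles the others.\<close>
    case (single w d)
    then show ?case using xy
      by (intro pconv_bilinear_eqI [where P = "\<lambda>x y. pconv pm (pconv pm x y) (Poly_Mapping.single w d) =
            pconv pm x (pconv pm y (Poly_Mapping.single w d))", OF xy])
        (auto simp: pconv_add_left pconv_add_right pconv_single A.m_assoc B.m_assoc mult.assoc)
  qed (simp_all add: pconv_add_right)
qed (auto simp: free_pair_simps)

lemma lookup_map_mult: "lookup (Poly_Mapping.map ((*) c) p) x = c * lookup (p :: _ \<Rightarrow>\<^sub>0 'k) x"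
  by (auto simp: map.rep_eq when_def)

lemma map_mult_add: "Poly_Mapping.map ((*) c) (p + q) = Poly_Mapping.map ((*) c) p + Poly_Mapping.map ((*) c) (q :: _ \<Rightarrow>\<^sub>0 'k)"
  by (rule poly_mapping_eqI) (simp add: lookup_map_mult lookup_add distrib_left)

lemma smult_free_pair:
  assumes "x \<in> carrier F"
  shows "c \<odot>\<^bsub>F\<^esub> x = (c \<odot>\<^bsub>F\<^esub> \<one>\<^bsub>F\<^esub>) \<otimes>\<^bsub>F\<^esub> x"
proof -
  have "keys x \<subseteq> carrier A \<times> carrier B" using assms by (simp add: free_pair_simps)
  then show ?thesis
    unfolding free_pair_simps
    by (induction x rule: poly_mapping_single_induct)
      (auto simp: pconv_add_right pconv_single map_mult_add intro!: poly_mapping_eqI simp: lookup_map_mult lookup_single when_def)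
qed

sublocale F: kalg F
  by (intro kalg.intro kalg_axioms.intro cring_free_pair smult_free_pair)
    (auto simp: free_pair_simps pconv_single single_add)

lemma free_pair_minus: "x \<in> carrier F \<Longrightarrow> y \<in> carrier F \<Longrightarrow> x \<ominus>\<^bsub>F\<^esub> y = x - y"
proof -
  assume xy: "x \<in> carrier F" "y \<in> carrier F"
  then have "\<ominus>\<^bsub>F\<^esub> y = - y"
    by (intro F.minus_equality) (auto simp: free_pair_simps)
  then show ?thesis by (simp add: a_minus_def free_pair_simps)
qed

end

subsection \<open>Tensor products\<close>

context kalg_pair
begin

abbreviation "TI \<equiv> tensor_ideal A B"
abbreviation "T \<equiv> tensor_alg A B"
abbreviation "pt \<equiv> pure_tensor A B"

lemma single_closed [simp]:
  "a \<in> carrier A \<Longrightarrow> b \<in> carrier B \<Longrightarrow> Poly_Mapping.single (a, b) c \<in> carrier F"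
  by (simp add: free_pair_simps)

lemma diff_closed: "x \<in> carrier F \<Longrightarrow> y \<in> carrier F \<Longrightarrow> x - y \<in> carrier F"
  using F.minus_closed [of x y] by (simp add: free_pair_minus)

lemma bilinear_rels_closed: "bilinear_rels A B \<subseteq> carrier F"
  unfolding bilinear_rels_def by (auto intro!: diff_closed single_closed)

sublocale TI: kalg_ideal F TI
  unfolding tensor_ideal_def
  by (intro kalg_ideal.intro F.kalg_axioms F.genideal_ideal bilinear_rels_closed)

sublocale T: kalg T
  unfolding tensor_alg_def by (rule TI.kalg_quot_alg)

lemma rel_in_tensor_ideal: "x \<in> bilinear_rels A B \<Longrightarrow> x \<in> TI"
  unfolding tensor_ideal_def using F.genideal_self [OF bilinear_rels_closed] by blast

lemma coset_eqI:
  assumes "x \<in> carrier F" "y \<in> carrier F" "x - y \<in> bilinear_rels A B"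
  shows "TI +>\<^bsub>F\<^esub> x = TI +>\<^bsub>F\<^esub> y"
  using assms by (simp add: TI.coset_eq_iff free_pair_minus rel_in_tensor_ideal)

lemma coset_hom_tensor: "(\<lambda>x. TI +>\<^bsub>F\<^esub> x) \<in> Ring.ring_hom F T"
  unfolding tensor_alg_def by (rule TI.coset_hom)

lemma coset_smult: "x \<in> carrier F \<Longrightarrow> c \<odot>\<^bsub>T\<^esub> (TI +>\<^bsub>F\<^esub> x) = TI +>\<^bsub>F\<^esub> (c \<odot>\<^bsub>F\<^esub> x)"
  unfolding tensor_alg_def by (rule TI.smult_coset)

lemma coset_add:
  "x \<in> carrier F \<Longrightarrow> y \<in> carrier F \<Longrightarrow> (TI +>\<^bsub>F\<^esub> x) \<oplus>\<^bsub>T\<^esub> (TI +>\<^bsub>F\<^esub> y) = TI +>\<^bsub>F\<^esub> (x + y)"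
  using ring_hom_add [OF coset_hom_tensor, of x y] by (simp add: free_pair_simps)

lemma coset_mult:
  "x \<in> carrier F \<Longrightarrow> y \<in> carrier F \<Longrightarrow> (TI +>\<^bsub>F\<^esub> x) \<otimes>\<^bsub>T\<^esub> (TI +>\<^bsub>F\<^esub> y) = TI +>\<^bsub>F\<^esub> (x \<otimes>\<^bsub>F\<^esub> y)"
  using ring_hom_mult [OF coset_hom_tensor, of x y] by simp

lemma carrier_tensor: "carrier T = (\<lambda>x. TI +>\<^bsub>F\<^esub> x) ` carrier F"
  unfolding tensor_alg_def by (rule quot_alg_carrier)

lemma pt_closed [simp]: "a \<in> carrier A \<Longrightarrow> b \<in> carrier B \<Longrightarrow> pt a b \<in> carrier T"
  by (auto simp: pure_tensor_def carrier_tensor)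

lemma pt_one: "pt \<one>\<^bsub>A\<^esub> \<one>\<^bsub>B\<^esub> = \<one>\<^bsub>T\<^esub>"
  using ring_hom_one [OF coset_hom_tensor] by (simp add: pure_tensor_def free_pair_simps)

lemma pt_mult:
  "a \<in> carrier A \<Longrightarrow> a' \<in> carrier A \<Longrightarrow> b \<in> carrier B \<Longrightarrow> b' \<in> carrier B \<Longrightarrow>
    pt a b \<otimes>\<^bsub>T\<^esub> pt a' b' = pt (a \<otimes>\<^bsub>A\<^esub> a') (b \<otimes>\<^bsub>B\<^esub> b')"
  by (simp add: pure_tensor_def coset_mult free_pair_simps(2) pconv_single)

lemma pt_add_left:
  assumes "a \<in> carrier A" "a' \<in> carrier A" "b \<in> carrier B"
  shows "pt (a \<oplus>\<^bsub>A\<^esub> a') b = pt a b \<oplus>\<^bsub>T\<^esub> pt a' b"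
proof -
  have "Poly_Mapping.single (a \<oplus>\<^bsub>A\<^esub> a', b) 1 - (Poly_Mapping.single (a, b) 1 + Poly_Mapping.single (a', b) 1)
      \<in> bilinear_rels A B"
    unfolding bilinear_rels_def diff_diff_eq [symmetric] using assms by blast
  then show ?thesis
    using assms F.add.m_closed [of "Poly_Mapping.single (a, b) 1" "Poly_Mapping.single (a', b) 1"]
    by (simp add: pure_tensor_def coset_add coset_eqI free_pair_simps(5))
qed

lemma pt_add_right:
  assumes "a \<in> carrier A" "b \<in> carrier B" "b' \<in> carrier B"
  shows "pt a (b \<oplus>\<^bsub>B\<^esub> b') = pt a b \<oplus>\<^bsub>T\<^esub> pt a b'"
proof -
  have "Poly_Mapping.single (a, b \<oplus>\<^bsub>B\<^esub> b') 1 - (Poly_Mapping.single (a, b) 1 + Poly_Mapping.single (a, b') 1)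
      \<in> bilinear_rels A B"
    unfolding bilinear_rels_def diff_diff_eq [symmetric] using assms by blast
  then show ?thesis
    using assms F.add.m_closed [of "Poly_Mapping.single (a, b) 1" "Poly_Mapping.single (a, b') 1"]
    by (simp add: pure_tensor_def coset_add coset_eqI free_pair_simps(5))
qed

lemma smult_single: "c \<odot>\<^bsub>F\<^esub> Poly_Mapping.single x 1 = Poly_Mapping.single x c"
  by (simp add: free_pair_simps)

lemma pt_smult_left:
  assumes "a \<in> carrier A" "b \<in> carrier B"
  shows "pt (c \<odot>\<^bsub>A\<^esub> a) b = c \<odot>\<^bsub>T\<^esub> pt a b"
proof -
  have "Poly_Mapping.single (c \<odot>\<^bsub>A\<^esub> a, b) 1 - Poly_Mapping.single (a, b) c \<in> bilinear_rels A B"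
    unfolding bilinear_rels_def using assms by blast
  then show ?thesis
    using assms by (simp add: pure_tensor_def coset_smult smult_single coset_eqI)
qed

lemma pt_smult_right:
  assumes "a \<in> carrier A" "b \<in> carrier B"
  shows "pt a (c \<odot>\<^bsub>B\<^esub> b) = c \<odot>\<^bsub>T\<^esub> pt a b"
proof -
  have "Poly_Mapping.single (a, c \<odot>\<^bsub>B\<^esub> b) 1 - Poly_Mapping.single (a, b) c \<in> bilinear_rels A B"
    unfolding bilinear_rels_def using assms by blast
  then show ?thesis
    using assms by (simp add: pure_tensor_def coset_smult smult_single coset_eqI)
qed

lemma pt_left_hom: "(\<lambda>a. pt a \<one>\<^bsub>B\<^esub>) \<in> Ring.ring_hom A T"
  by (intro ring_hom_memI) (simp_all add: pt_one pt_mult pt_add_left)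

lemma pt_right_hom: "(\<lambda>b. pt \<one>\<^bsub>A\<^esub> b) \<in> Ring.ring_hom B T"
  by (intro ring_hom_memI) (simp_all add: pt_one pt_mult pt_add_right)

lemma pt_left_right:
  "a \<in> carrier A \<Longrightarrow> b \<in> carrier B \<Longrightarrow> pt a \<one>\<^bsub>B\<^esub> \<otimes>\<^bsub>T\<^esub> pt \<one>\<^bsub>A\<^esub> b = pt a b"
  by (simp add: pt_mult)

end

section \<open>The coaction\<close>

lemma ring_hom_poly_alg_sum:
  assumes "cring A" "h \<in> Ring.ring_hom (poly_alg V) A" "h 0 = \<zero>\<^bsub>A\<^esub>" "finite K"
    "\<And>k. k \<in> K \<Longrightarrow> f k \<in> carrier (poly_alg V)"
  shows "h (sum f K) = (\<Oplus>\<^bsub>A\<^esub>k\<in>K. h (f k))"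
proof -
  interpret cring A by fact
  show ?thesis
    using assms(4,5)
  proof (induction K rule: finite_induct)
    case (insert k K)
    then have "h (f k + sum f K) = h (f k) \<oplus>\<^bsub>A\<^esub> h (sum f K)"
      using ring_hom_add [OF assms(2), of "f k" "sum f K"] by (simp add: poly_alg_sum)
    then show ?case
      using insert ring_hom_closed [OF assms(2)] by (simp add: Pi_iff)
  qed (simp add: assms(3))
qed

lemma ring_hom_peval:
  assumes "\<And>v. v \<in> V \<Longrightarrow> \<phi> v \<in> carrier (poly_alg W)"
  shows "peval mconst \<phi> \<in> Ring.ring_hom (poly_alg V) (poly_alg W)"
proof (rule ring_hom_memI)
  interpret p: comm_ring_hom "peval mconst \<phi>" by (rule mconst.comm_ring_hom_peval)
  show "peval mconst \<phi> p \<in> carrier (poly_alg W)" if "p \<in> carrier (poly_alg V)" for p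
    using that by (induction p rule: mpol_mvar_induct) (auto simp: p.hom_add p.hom_mult assms)
qed (simp_all add: mconst.peval_add mconst.peval_mult flip: mconst.hom_one)

lemma ring_hom_compose:
  "f \<in> Ring.ring_hom A B \<Longrightarrow> g \<in> Ring.ring_hom B C \<Longrightarrow> (\<lambda>x. g (f x)) \<in> Ring.ring_hom A C"
  by (auto simp: Ring.ring_hom_def Pi_iff)

lemma poly_alg_a_inv: "p \<in> carrier (poly_alg V) \<Longrightarrow> \<ominus>\<^bsub>poly_alg V\<^esub> p = - p"
proof -
  interpret kalg "poly_alg V :: ('b, ('a, 'b) mpol) module" by (rule kalg_poly_alg)
  show "p \<in> carrier (poly_alg V) \<Longrightarrow> \<ominus>\<^bsub>poly_alg V\<^esub> p = - p"
    by (intro minus_equality) auto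
qed

lemma poly_alg_diff_closed:
  "p \<in> carrier (poly_alg V) \<Longrightarrow> q \<in> carrier (poly_alg V) \<Longrightarrow> p - q \<in> carrier (poly_alg V)"
  unfolding diff_conv_add_uminus by (intro poly_alg_closed)

lemma gdet_closed: "gdet m \<in> carrier (kMat m)"
  unfolding kMat_def by (intro row_det_closed) auto

lemma gdet_minus_1_closed: "gdet m - 1 \<in> carrier (kMat m)"
  using gdet_closed poly_alg_diff_closed poly_alg_closed(3) unfolding kMat_def by blast

lemma kalg_ideal_SL: "kalg_ideal (kMat m :: ('k::comm_ring_1, (int \<times> int, 'k) mpol) module) (SL_ideal m)"
proof -
  interpret M: kalg "kMat m :: ('k, (int \<times> int, 'k) mpol) module" unfolding kMat_def by (rule kalg_poly_alg)
  show ?thesis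
    unfolding SL_ideal_def
    by (intro kalg_ideal.intro M.kalg_axioms M.genideal_ideal) (simp add: gdet_minus_1_closed)
qed

text \<open>The argument \<open>K_type\<close> fixes the scalar type, which \<open>m\<close> and
  \<open>n\<close> do not determine.\<close>

locale coaction =
  fixes m n :: nat and K_type :: "'k::comm_ring_1 itself"
begin

abbreviation "KB \<equiv> kb m n :: ('k, (int \<times> int, 'k) mpol) module"
abbreviation "KM \<equiv> kMat m :: ('k, (int \<times> int, 'k) mpol) module"
abbreviation "KS \<equiv> kSL m :: ('k, (int \<times> int, 'k) mpol set) module"
abbreviation "cs \<equiv> \<lambda>g :: (int \<times> int, 'k) mpol. SL_ideal m +>\<^bsub>kMat m\<^esub> g"
abbreviation "V1 \<equiv> {- int m..int n - 1} \<times> {- int m..-1}"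
abbreviation "V2 \<equiv> {- int m..-1} \<times> {- int m..-1}"

sublocale SL: kalg_ideal KM "SL_ideal m"
  by (rule kalg_ideal_SL)

sublocale kalg_pair KB KS
  unfolding kSL_def by (intro kalg_pair.intro SL.kalg_quot_alg) (simp add: kb_def kalg_poly_alg)

lemma cs_hom: "cs \<in> Ring.ring_hom KM KS"
  unfolding kSL_def by (rule SL.coset_hom)

lemma cs_closed: "g \<in> carrier KM \<Longrightarrow> cs g \<in> carrier KS"
  using ring_hom_closed [OF cs_hom] .

lemma cs_mconst: "cs (mconst c) = c \<odot>\<^bsub>KS\<^esub> \<one>\<^bsub>KS\<^esub>"
  using SL.smult_coset [of 1 c] ring_hom_one [OF cs_hom] by (simp add: kSL_def kMat_def)

lemma gdet_minus_1_in: "gdet m - 1 \<in> (SL_ideal m :: (int \<times> int, 'k) mpol set)"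
  unfolding SL_ideal_def by (rule SL.genideal_self') (rule gdet_minus_1_closed)

lemma KM_closed: "p \<in> carrier KM \<longleftrightarrow> p \<in> carrier (poly_alg V2)"
  by (simp add: kMat_def)

lemma cs_mvar_closed: "v \<in> V2 \<Longrightarrow> cs (mvar v) \<in> carrier KS"
  by (intro cs_closed) (simp add: KM_closed poly_alg_closed(7))

lemma SL_minus: "x \<in> carrier KM \<Longrightarrow> y \<in> carrier KM \<Longrightarrow> x \<ominus>\<^bsub>KM\<^esub> y = x - y"
  by (simp add: a_minus_def kMat_def poly_alg_a_inv)

lemma cs_gdet: "cs (gdet m) = \<one>\<^bsub>KS\<^esub>"
proof -
  have closed: "gdet m \<in> carrier KM" "1 \<in> carrier KM"
    by (rule gdet_closed) (simp add: KM_closed)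
  have "cs (gdet m) = cs 1"
    using gdet_minus_1_in unfolding SL.coset_eq_iff [OF closed] SL_minus [OF closed] .
  then show ?thesis using ring_hom_one [OF cs_hom] by (simp add: kMat_def)
qed

lemma KB_closed [simp]: "p \<in> carrier KB \<longleftrightarrow> p \<in> carrier (poly_alg V1)"
  by (simp add: kb_def)

lemma KB_simps [simp]:
  "p \<otimes>\<^bsub>KB\<^esub> q = p * q" "p \<oplus>\<^bsub>KB\<^esub> q = p + q" "\<one>\<^bsub>KB\<^esub> = 1" "c \<odot>\<^bsub>KB\<^esub> p = mconst c * p"
  by (simp_all add: kb_def)

definition rv :: "int \<times> int \<Rightarrow> 'k tens" where
  "rv = (\<lambda>(i, j). \<Oplus>\<^bsub>T\<^esub>k\<in>{- int m..-1}. pt (mvar (i, k)) (SL_coord m k j))"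

lemma rho_eq: "rho m n = alg_eval T rv"
  by (simp add: rho_def rv_def)

lemma SL_coord_eq: "SL_coord m k j = cs (mvar (k, j))"
  by (simp add: SL_coord_def)

lemma rv_closed: "rv \<in> V1 \<rightarrow> carrier T"
  by (auto simp: rv_def SL_coord_eq intro!: T.finsum_closed pt_closed cs_mvar_closed poly_alg_closed(7))

lemma rho_hom: "rho m n \<in> Ring.ring_hom (poly_alg V1) T"
  unfolding rho_eq by (rule T.alg_eval_hom [OF rv_closed])

lemma rho_mconst: "rho m n (mconst c) = c \<odot>\<^bsub>T\<^esub> \<one>\<^bsub>T\<^esub>"
  unfolding rho_eq by (rule T.alg_eval_mconst [OF rv_closed])

lemma rho_mvar: "v \<in> V1 \<Longrightarrow> rho m n (mvar v) = rv v"
  unfolding rho_eq by (rule T.alg_eval_mvar [OF rv_closed])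

lemma pt_left_mconst: "pt (mconst c) \<one>\<^bsub>KS\<^esub> = c \<odot>\<^bsub>T\<^esub> \<one>\<^bsub>T\<^esub>"
  using pt_smult_left [of 1 "\<one>\<^bsub>KS\<^esub>" c] pt_one by simp

lemma pt_left_poly_hom: "(\<lambda>p. pt p \<one>\<^bsub>KS\<^esub>) \<in> Ring.ring_hom (poly_alg V1) T"
  using pt_left_hom by (simp add: kb_def)

subsection \<open>Minors are coinvariant\<close>

text \<open>The map \<open>\<kappa>\<close> from the polynomial ring in the \<open>b\<^sub>i\<^sub>j\<close> and the \<open>g\<^sub>i\<^sub>j\<close> onto the tensor product:
  both \<open>\<rho>\<close> and \<open>p \<mapsto> p \<otimes> 1\<close> factor through it, so determinants can be multiplied in a
  polynomial ring.\<close>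

definition kv :: "(int \<times> int) + (int \<times> int) \<Rightarrow> 'k tens" where
  "kv = case_sum (\<lambda>v. pt (mvar v) \<one>\<^bsub>KS\<^esub>) (\<lambda>v. pt 1 (cs (mvar v)))"

abbreviation "W \<equiv> Inl ` V1 \<union> Inr ` V2"

lemma kv_closed: "kv \<in> W \<rightarrow> carrier T"
  by (auto simp: kv_def intro!: pt_closed cs_mvar_closed poly_alg_closed(7))

lemma kv_simps: "kv (Inl v) = pt (mvar v) \<one>\<^bsub>KS\<^esub>" "kv (Inr v) = pt 1 (cs (mvar v))"
  by (simp_all add: kv_def)

abbreviation "\<kappa> \<equiv> alg_eval T kv"

lemma \<kappa>_hom: "\<kappa> \<in> Ring.ring_hom (poly_alg W) T"
  by (rule T.alg_eval_hom [OF kv_closed])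

lemma \<kappa>_mconst: "\<kappa> (mconst c) = c \<odot>\<^bsub>T\<^esub> \<one>\<^bsub>T\<^esub>"
  by (rule T.alg_eval_mconst [OF kv_closed])

lemma \<kappa>_mvar: "v \<in> W \<Longrightarrow> \<kappa> (mvar v) = kv v"
  by (rule T.alg_eval_mvar [OF kv_closed])

definition "inl = (peval mconst (\<lambda>v. mvar (Inl v)) :: (int \<times> int, 'k) mpol \<Rightarrow> ((int \<times> int) + (int \<times> int), 'k) mpol)"
definition "inr = (peval mconst (\<lambda>v. mvar (Inr v)) :: (int \<times> int, 'k) mpol \<Rightarrow> ((int \<times> int) + (int \<times> int), 'k) mpol)"
text \<open>The entries of the product B G of the two generic matrices, in the polynomial ring
  k[B, G].\<close>

definition "mulv = (\<lambda>(i, j). \<Sum>k\<in>{- int m..-1}. mvar (Inl (i, k)) * mvar (Inr (k, j)) :: ((int \<times> int) + (int \<times> int), 'k) mpol)"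

lemma inl_hom: "inl \<in> Ring.ring_hom (poly_alg V1) (poly_alg W)"
  unfolding inl_def by (rule ring_hom_peval) auto

lemma inr_hom: "inr \<in> Ring.ring_hom (poly_alg V2) (poly_alg W)"
  unfolding inr_def by (rule ring_hom_peval) auto

lemma mulv_hom: "peval mconst mulv \<in> Ring.ring_hom (poly_alg V1) (poly_alg W)"
  by (rule ring_hom_peval) (auto simp: mulv_def intro!: poly_alg_sum poly_alg_closed(5,7))

lemma \<kappa>_inl: "p \<in> carrier (poly_alg V1) \<Longrightarrow> \<kappa> (inl p) = pt p \<one>\<^bsub>KS\<^esub>"
  by (rule ring_hom_poly_alg_eqI [OF ring_hom_compose [OF inl_hom \<kappa>_hom] pt_left_poly_hom])
    (simp_all add: inl_def \<kappa>_mconst pt_left_mconst \<kappa>_mvar kv_simps)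

lemma \<kappa>_inr: "g \<in> carrier (poly_alg V2) \<Longrightarrow> \<kappa> (inr g) = pt 1 (cs g)"
proof (rule ring_hom_poly_alg_eqI [OF ring_hom_compose [OF inr_hom \<kappa>_hom]])
  show "(\<lambda>g. pt 1 (cs g)) \<in> Ring.ring_hom (poly_alg V2) T"
    using ring_hom_compose [OF cs_hom pt_right_hom] by (simp add: kMat_def)
  show "\<kappa> (inr (mconst c)) = pt 1 (cs (mconst c))" for c
    using pt_smult_right [of 1 "\<one>\<^bsub>KS\<^esub>" c] pt_one by (simp add: inr_def \<kappa>_mconst cs_mconst)
qed (simp_all add: inr_def \<kappa>_mvar kv_simps)

text \<open>Both sides are homomorphisms, compared on the variables: there a sum of products b_ik
  g_kj becomes a sum of pure tensors b_ik \<otimes> g_kj.\<close>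

lemma \<kappa>_mulv: "p \<in> carrier (poly_alg V1) \<Longrightarrow> \<kappa> (peval mconst mulv p) = rho m n p"
proof (rule ring_hom_poly_alg_eqI [OF ring_hom_compose [OF mulv_hom \<kappa>_hom] rho_hom])
  fix v assume v: "v \<in> V1"
  then obtain i j where ij: "v = (i, j)" "i \<in> {- int m..int n - 1}" "j \<in> {- int m..-1}" by auto
  have "\<kappa> (mulv v) = (\<Oplus>\<^bsub>T\<^esub>k\<in>{- int m..-1}. \<kappa> (mvar (Inl (i, k)) * mvar (Inr (k, j))))"
    unfolding ij(1) mulv_def prod.case
  proof (rule ring_hom_poly_alg_sum [OF T.is_cring \<kappa>_hom])
    show "\<kappa> 0 = \<zero>\<^bsub>T\<^esub>" using \<kappa>_mconst [of 0] by (simp add: mconst.hom_zero)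
  qed (use ij in \<open>auto intro!: poly_alg_closed(5,7)\<close>)
  also have "\<dots> = (\<Oplus>\<^bsub>T\<^esub>k\<in>{- int m..-1}. pt (mvar (i, k)) (cs (mvar (k, j))))"
  proof (rule T.finsum_cong' [OF refl])
    have k: "\<kappa> (mvar (Inl (i, k)) * mvar (Inr (k, j))) = pt (mvar (i, k)) (cs (mvar (k, j))) \<and>
        pt (mvar (i, k)) (cs (mvar (k, j))) \<in> carrier T" if "k \<in> {- int m..-1}" for k
    proof -
      have *: "(i, k) \<in> V1" "(k, j) \<in> V2" using ij that by auto
      then have "\<kappa> (mvar (Inl (i, k)) * mvar (Inr (k, j))) = kv (Inl (i, k)) \<otimes>\<^bsub>T\<^esub> kv (Inr (k, j))"
        using ring_hom_mult [OF \<kappa>_hom, of "mvar (Inl (i, k))" "mvar (Inr (k, j))"]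
        by (simp add: \<kappa>_mvar poly_alg_closed(7))
      moreover have "cs (mvar (k, j)) \<in> carrier KS"
        using * by (intro cs_mvar_closed)
      ultimately show ?thesis
        using pt_left_right [of "mvar (i, k)" "cs (mvar (k, j))"] * by (simp add: kv_simps poly_alg_closed(7))
    qed
    then show "(\<lambda>k. pt (mvar (i, k)) (cs (mvar (k, j)))) \<in> {- int m..-1} \<rightarrow> carrier T" by blast
    show "\<kappa> (mvar (Inl (i, k)) * mvar (Inr (k, j))) = pt (mvar (i, k)) (cs (mvar (k, j)))"
      if "k \<in> {- int m..-1}" for k
      using k [OF that] by blast
  qed
  also have "\<dots> = rho m n (mvar v)"
    using v by (simp add: rho_mvar) (simp add: ij(1) rv_def SL_coord_eq)
  finally show "\<kappa> (peval mconst mulv (mvar v)) = rho m n (mvar v)" by simp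
qed (simp_all add: \<kappa>_mconst rho_mconst)

text \<open>In k[B, G] the determinant of the chosen rows of B G is that of the rows of B times det
  G, and det G becomes 1 in the coordinate ring of SL.\<close>

lemma rho_row_det:
  assumes "l ` {..<m} \<subseteq> {- int m..int n - 1}"
  shows "rho m n (row_det m l) = pt (row_det m l) \<one>\<^bsub>KS\<^esub>"
proof -
  have closed: "row_det m l \<in> carrier (poly_alg V1 :: ('k, (int \<times> int, 'k) mpol) module)"
    using assms by (intro row_det_closed) auto
  have gclosed: "gdet m \<in> carrier (poly_alg V2 :: ('k, (int \<times> int, 'k) mpol) module)"
    using gdet_closed [of m] by (simp add: kMat_def)
  have "peval mconst mulv (row_det m l) = inl (row_det m l) * inr (gdet m)"
    unfolding inl_def inr_def mconst.peval_row_det mulv_def prod.case det_sum_prod ..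
  then have "rho m n (row_det m l) = \<kappa> (inl (row_det m l)) \<otimes>\<^bsub>T\<^esub> \<kappa> (inr (gdet m))"
    using \<kappa>_mulv [OF closed] ring_hom_mult [OF \<kappa>_hom, of "inl (row_det m l)" "inr (gdet m)"]
      ring_hom_closed [OF inl_hom closed] ring_hom_closed [OF inr_hom gclosed] by simp
  then show ?thesis
    using closed gclosed pt_one by (simp add: \<kappa>_inl \<kappa>_inr cs_gdet)
qed

text \<open>The polynomials on which two algebra homomorphisms agree form a subalgebra, so the
  generators decide. Membership in the polynomial ring is part of the induction because the
  homomorphism laws hold only there.\<close>

lemma coinvariant_kdelta:
  assumes "p \<in> carrier (kdelta m n)"
  shows "p \<in> carrier (poly_alg V1) \<and> rho m n p = pt p \<one>\<^bsub>KS\<^esub>"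
proof -
  have const: "mconst c \<in> carrier (poly_alg V1) \<and> rho m n (mconst c) = pt (mconst c) \<one>\<^bsub>KS\<^esub>" for c
    by (simp add: rho_mconst pt_left_mconst)
  have mult: "p * q \<in> carrier (poly_alg V1) \<and> rho m n (p * q) = pt (p * q) \<one>\<^bsub>KS\<^esub>"
    if "p \<in> carrier (poly_alg V1) \<and> rho m n p = pt p \<one>\<^bsub>KS\<^esub>"
      "q \<in> carrier (poly_alg V1) \<and> rho m n q = pt q \<one>\<^bsub>KS\<^esub>" for p q
    using that ring_hom_mult [OF rho_hom, of p q] ring_hom_mult [OF pt_left_poly_hom, of p q]
    by (simp add: poly_alg_closed(5))
  have "p \<in> generate_ring KB ({c \<odot>\<^bsub>KB\<^esub> \<one>\<^bsub>KB\<^esub> |c. True} \<union>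
      {row_det m l |l. strict_mono_on {..<m} l \<and> l ` {..<m} \<subseteq> {- int m .. int n - 1}})"
    using assms by (simp add: kdelta_def gen_subalg_def)
  then show ?thesis
  proof (induction p rule: generate_ring.induct)
    case one
    show ?case using const [of 1] by (simp add: mconst.hom_one)
  next
    case (incl p)
    then show ?case
    proof (elim UnE CollectE exE conjE)
      fix c assume "p = c \<odot>\<^bsub>KB\<^esub> \<one>\<^bsub>KB\<^esub>"
      then show ?thesis using const [of c] by simp
    next
      fix l assume "p = row_det m l" "l ` {..<m} \<subseteq> {- int m .. int n - 1}"
      then show ?thesis using rho_row_det row_det_closed [of l m "{- int m .. int n - 1}" "{- int m..-1}"] by simp
    qed
  next
    case (a_inv p)
    \<comment> \<open>Negation is multiplication by a scalar, which reduces it to the cases of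
      constants and products.\<close>
    have "mconst (- 1) * p = - p" by (simp add: mconst.hom_uminus mconst.hom_one)
    then show ?case
      using mult [OF const [of "- 1"] a_inv.IH] a_inv.IH by (simp add: kb_def poly_alg_a_inv)
  next
    case (eng_add p q)
    then show ?case
      using ring_hom_add [OF rho_hom, of p q] ring_hom_add [OF pt_left_poly_hom, of p q]
      by (simp add: poly_alg_closed(4))
  next
    case (eng_mult p q)
    then show ?case using mult by simp
  qed
qed

end

subsection \<open>Coinvariants are polynomials in the minors\<close>

lemma dvd_diff_mult:
  fixes e :: "'a::comm_ring_1"
  assumes "e dvd a - a'" "e dvd b - b'"
  shows "e dvd a * b - a' * b'"
proof -
  have "a * b - a' * b' = (a - a') * b + a' * (b - b')" by (simp add: algebra_simps)
  then show ?thesis using assms by (simp add: dvd_add dvd_mult dvd_mult2)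
qed

lemma dvd_diff_add:
  fixes e :: "'a::comm_ring_1"
  assumes "e dvd a - a'" "e dvd b - b'"
  shows "e dvd (a + b) - (a' + b')"
  using dvd_add [OF assms] by (simp add: algebra_simps)

lemma dvd_diff_trans:
  fixes e :: "'a::comm_ring_1"
  assumes "e dvd a - b" "e dvd b - c"
  shows "e dvd a - c"
  using dvd_add [OF assms] by simp

context coaction
begin

definition cong :: "(int \<times> int, (int \<times> int, 'k) mpol) mpol \<Rightarrow> (int \<times> int, (int \<times> int, 'k) mpol) mpol \<Rightarrow> bool" where
  "cong f g \<longleftrightarrow> (gdet m - 1) dvd (f - g)"

lemma cong_refl [simp]: "cong f f"
  by (simp add: cong_def)

lemma cong_sym: "cong f g \<Longrightarrow> cong g f"
  unfolding cong_def by (subst dvd_minus_iff [symmetric]) simp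

lemma cong_trans: "cong f g \<Longrightarrow> cong g h \<Longrightarrow> cong f h"
  unfolding cong_def by (rule dvd_diff_trans)

lemma cong_add: "cong f g \<Longrightarrow> cong f' g' \<Longrightarrow> cong (f + f') (g + g')"
  unfolding cong_def by (rule dvd_diff_add)

lemma cong_mult: "cong f g \<Longrightarrow> cong f' g' \<Longrightarrow> cong (f * f') (g * g')"
  unfolding cong_def by (rule dvd_diff_mult)

text \<open>The multiples of det X - 1 in the carrier form an ideal that contains the generator, and
  the generated ideal is the least such.\<close>

lemma SL_ideal_dvd:
  assumes "x \<in> SL_ideal m"
  shows "(gdet m - 1 :: (int \<times> int, 'k) mpol) dvd x"
proof -
  have "SL_ideal m \<subseteq> {x \<in> carrier KM. (gdet m - 1) dvd x}"
    unfolding SL_ideal_def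
  proof (rule SL.genideal_minimal)
    show "ideal {x \<in> carrier KM. (gdet m - 1) dvd x} KM"
    proof (rule idealI [OF SL.ring_axioms])
      show "subgroup {x \<in> carrier KM. (gdet m - 1) dvd x} (add_monoid KM)"
      proof (rule subgroup.intro)
        fix x assume "x \<in> {x \<in> carrier KM. (gdet m - 1) dvd x}"
        then show "inv\<^bsub>add_monoid KM\<^esub> x \<in> {x \<in> carrier KM. (gdet m - 1) dvd x}"
          unfolding a_inv_def [symmetric] by (simp add: kMat_def poly_alg_a_inv poly_alg_closed(6))
      qed (auto simp: kMat_def poly_alg_closed)
    qed (auto simp: kMat_def poly_alg_closed)
  qed (use gdet_minus_1_closed in auto)
  then show ?thesis using assms by blast
qed

abbreviation "\<iota> \<equiv> mmap mconst :: (int \<times> int, 'k) mpol \<Rightarrow> (int \<times> int, (int \<times> int, 'k) mpol) mpol"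

text \<open>An arbitrary lift of a coset. Different choices agree modulo det X - 1, which is why
  sums, products and scalars are respected only up to \<open>cong\<close>.\<close>

definition rep :: "(int \<times> int, 'k) mpol set \<Rightarrow> (int \<times> int, (int \<times> int, 'k) mpol) mpol" where
  "rep b = \<iota> (SOME g. g \<in> b)"

interpretation mm: comm_ring_hom \<iota>
  by (rule mconst.comm_ring_hom_mmap)

lemma rep_cs:
  assumes "g \<in> carrier KM"
  shows "cong (rep (cs g)) (\<iota> g)"
proof -
  have "g \<in> cs g" by (rule SL.a_rcos_self [OF assms])
  then have "(SOME g'. g' \<in> cs g) \<in> cs g" by (rule someI)
  then obtain x where "x \<in> SL_ideal m" "(SOME g'. g' \<in> cs g) = x + g"
    by (auto simp: a_r_coset_def r_coset_def kMat_def)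
  then have "(gdet m - 1) dvd ((SOME g'. g' \<in> cs g) - g)"
    by (simp add: SL_ideal_dvd)
  then have "\<iota> (gdet m - 1) dvd \<iota> ((SOME g'. g' \<in> cs g) - g)"
    by (rule mm.hom_dvd)
  then show ?thesis
    by (simp add: cong_def rep_def mm.hom_minus mconst.mmap_row_det)
qed

lemma KS_carrierE:
  assumes "b \<in> carrier KS"
  obtains g where "g \<in> carrier KM" "b = cs g"
  using assms unfolding kSL_def quot_alg_carrier by blast

lemma rep_add:
  assumes "b \<in> carrier KS" "b' \<in> carrier KS"
  shows "cong (rep (b \<oplus>\<^bsub>KS\<^esub> b')) (rep b + rep b')"
proof -
  obtain g g' where g: "g \<in> carrier KM" "b = cs g" "g' \<in> carrier KM" "b' = cs g'"
    using assms by (metis KS_carrierE)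
  then have "b \<oplus>\<^bsub>KS\<^esub> b' = cs (g + g')" "g + g' \<in> carrier KM"
    using ring_hom_add [OF cs_hom, of g g'] by (simp_all add: kMat_def poly_alg_closed(4))
  then have "cong (rep (b \<oplus>\<^bsub>KS\<^esub> b')) (\<iota> g + \<iota> g')"
    using rep_cs [of "g + g'"] by (simp add: mm.hom_add)
  moreover have "cong (\<iota> g + \<iota> g') (rep b + rep b')"
    unfolding g(2,4) by (intro cong_add cong_sym [OF rep_cs] g)
  ultimately show ?thesis by (rule cong_trans)
qed

lemma rep_mult:
  assumes "b \<in> carrier KS" "b' \<in> carrier KS"
  shows "cong (rep (b \<otimes>\<^bsub>KS\<^esub> b')) (rep b * rep b')"
proof -
  obtain g g' where g: "g \<in> carrier KM" "b = cs g" "g' \<in> carrier KM" "b' = cs g'"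
    using assms by (metis KS_carrierE)
  then have "b \<otimes>\<^bsub>KS\<^esub> b' = cs (g * g')" "g * g' \<in> carrier KM"
    using ring_hom_mult [OF cs_hom, of g g'] by (simp_all add: kMat_def poly_alg_closed(5))
  then have "cong (rep (b \<otimes>\<^bsub>KS\<^esub> b')) (\<iota> g * \<iota> g')"
    using rep_cs [of "g * g'"] by (simp add: mm.hom_mult)
  moreover have "cong (\<iota> g * \<iota> g') (rep b * rep b')"
    unfolding g(2,4) by (intro cong_mult cong_sym [OF rep_cs] g)
  ultimately show ?thesis by (rule cong_trans)
qed

lemma rep_one: "cong (rep \<one>\<^bsub>KS\<^esub>) 1"
  using rep_cs [of 1] ring_hom_one [OF cs_hom] by (simp add: kMat_def mm.hom_one)

lemma rep_smult:
  assumes "b \<in> carrier KS"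
  shows "cong (rep (c \<odot>\<^bsub>KS\<^esub> b)) (mconst (mconst c) * rep b)"
proof -
  have "cong (rep (c \<odot>\<^bsub>KS\<^esub> \<one>\<^bsub>KS\<^esub>)) (mconst (mconst c))"
    using rep_cs [of "mconst c"] by (simp add: cs_mconst KM_closed)
  then show ?thesis
    unfolding B.smult_eq [OF assms, of c]
    by (intro cong_trans [OF rep_mult [OF B.smult_one_closed assms]] cong_mult cong_refl)
qed

text \<open>The linear map on formal combinations that sends a pair (a, b) to a times a lift of b.
  It is exactly additive, but products and the tensor relations are respected only modulo det X -
  1.\<close>

definition \<theta> :: "((int \<times> int, 'k) mpol \<times> (int \<times> int, 'k) mpol set \<Rightarrow>\<^sub>0 'k) \<Rightarrow> (int \<times> int, (int \<times> int, 'k) mpol) mpol" where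
  "\<theta> x = (\<Sum>ab\<in>keys x. mconst (mconst (lookup x ab) * fst ab) * rep (snd ab))"

lemma \<theta>_superset:
  assumes "finite S" "keys x \<subseteq> S"
  shows "\<theta> x = (\<Sum>ab\<in>S. mconst (mconst (lookup x ab) * fst ab) * rep (snd ab))"
  unfolding \<theta>_def using assms
  by (intro sum.mono_neutral_left) (auto simp: in_keys_iff mconst.hom_zero)

lemma \<theta>_add: "\<theta> (x + y) = \<theta> x + \<theta> y"
proof -
  have "keys (x + y) \<subseteq> keys x \<union> keys y" by (rule keys_add)
  then show ?thesis
    by (simp add: \<theta>_superset [of "keys x \<union> keys y"] lookup_add mconst.hom_add distrib_right sum.distrib)
qed

lemma \<theta>_zero [simp]: "\<theta> 0 = 0"
  by (simp add: \<theta>_def)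

lemma \<theta>_uminus: "\<theta> (- x) = - \<theta> x"
  using \<theta>_add [of x "- x"] by (simp add: eq_neg_iff_add_eq_0 add.commute)

lemma \<theta>_diff: "\<theta> (x - y) = \<theta> x - \<theta> y"
  using \<theta>_add [of x "- y"] by (simp add: \<theta>_uminus)

lemma \<theta>_single: "\<theta> (Poly_Mapping.single (a, b) c) = mconst (mconst c * a) * rep b"
  by (subst \<theta>_superset [of "{(a, b)}"]) auto

lemma \<theta>_mult:
  assumes "x \<in> carrier F" "y \<in> carrier F"
  shows "cong (\<theta> (x \<otimes>\<^bsub>F\<^esub> y)) (\<theta> x * \<theta> y)"
proof -
  let ?K = "carrier KB \<times> carrier KS"
  have "keys x \<subseteq> ?K" "keys y \<subseteq> ?K" using assms by (simp_all add: free_pair_simps(1))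
  then show ?thesis
    unfolding free_pair_simps(2)
  proof (rule pconv_bilinear_eqI [where P = "\<lambda>x y. cong (\<theta> (pconv pm x y)) (\<theta> x * \<theta> y)"])
    fix ab ab' c c' assume "ab \<in> ?K" "ab' \<in> ?K"
    then have "cong (rep (snd ab \<otimes>\<^bsub>KS\<^esub> snd ab')) (rep (snd ab) * rep (snd ab'))"
      by (intro rep_mult) auto
    then have "cong (mconst (mconst c * fst ab) * mconst (mconst c' * fst ab') * rep (snd ab \<otimes>\<^bsub>KS\<^esub> snd ab'))
        (mconst (mconst c * fst ab) * mconst (mconst c' * fst ab') * (rep (snd ab) * rep (snd ab')))"
      by (intro cong_mult cong_refl)
    then show "cong (\<theta> (pconv pm (Poly_Mapping.single ab c) (Poly_Mapping.single ab' c')))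
        (\<theta> (Poly_Mapping.single ab c) * \<theta> (Poly_Mapping.single ab' c'))"
      by (cases ab; cases ab') (simp add: pconv_single \<theta>_single mconst.hom_mult mult_ac)
  qed (simp_all add: pconv_add_left pconv_add_right \<theta>_add distrib_left distrib_right cong_add)
qed

text \<open>The combinations sent to 0 modulo det X - 1 form an ideal, so it suffices to treat the
  four kinds of bilinearity relations.\<close>

lemma \<theta>_tensor_ideal:
  assumes "x \<in> TI"
  shows "cong (\<theta> x) 0"
proof -
  have "TI \<subseteq> {x \<in> carrier F. cong (\<theta> x) 0}"
    unfolding tensor_ideal_def
  proof (rule F.genideal_minimal)
    show "ideal {x \<in> carrier F. cong (\<theta> x) 0} F"
    proof (rule idealI [OF F.ring_axioms])
      show "subgroup {x \<in> carrier F. cong (\<theta> x) 0} (add_monoid F)"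
      proof (rule subgroup.intro)
        show "x \<otimes>\<^bsub>add_monoid F\<^esub> y \<in> {x \<in> carrier F. cong (\<theta> x) 0}"
          if "x \<in> {x \<in> carrier F. cong (\<theta> x) 0}" "y \<in> {x \<in> carrier F. cong (\<theta> x) 0}" for x y
          using that cong_add [of "\<theta> x" 0 "\<theta> y" 0] F.add.m_closed [of x y]
          by (simp add: free_pair_simps(5) \<theta>_add)
        show "inv\<^bsub>add_monoid F\<^esub> x \<in> {x \<in> carrier F. cong (\<theta> x) 0}"
          if "x \<in> {x \<in> carrier F. cong (\<theta> x) 0}" for x
        proof -
          have "\<ominus>\<^bsub>F\<^esub> x = - x"
            using that free_pair_minus [of 0 x] F.zero_closed F.minus_eq [of 0 x] F.a_inv_closed [of x]
            by (simp add: free_pair_simps(4,5))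
          then show ?thesis
            using that F.a_inv_closed [of x] by (simp add: \<theta>_uminus cong_def flip: a_inv_def)
        qed
      qed (use F.zero_closed in \<open>auto simp: free_pair_simps(4)\<close>)
    next
      fix x y assume x: "x \<in> {x \<in> carrier F. cong (\<theta> x) 0}" and y: "y \<in> carrier F"
      then have "cong (\<theta> y * \<theta> x) (\<theta> y * 0)" by (intro cong_mult) auto
      then have "cong (\<theta> (y \<otimes>\<^bsub>F\<^esub> x)) 0"
        using x y \<theta>_mult [of y x] cong_trans by auto
      then show "y \<otimes>\<^bsub>F\<^esub> x \<in> {x \<in> carrier F. cong (\<theta> x) 0}" "x \<otimes>\<^bsub>F\<^esub> y \<in> {x \<in> carrier F. cong (\<theta> x) 0}"
        using x y by (simp_all add: F.m_comm [of x y])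
    qed
    \<comment> \<open>Relations in the left factor, \<open>1\<close> and \<open>3\<close>, hold
      exactly; those in the right factor, \<open>2\<close> and \<open>4\<close>, hold only up to the
      choice of lifts.\<close>
    have 1: "cong (\<theta> (Poly_Mapping.single (a + a', b) 1 - Poly_Mapping.single (a, b) 1 - Poly_Mapping.single (a', b) 1)) 0" for a a' b
      by (simp add: \<theta>_diff \<theta>_single mconst.hom_add mconst.hom_one distrib_right)
    have 2: "cong (\<theta> (Poly_Mapping.single (a, b \<oplus>\<^bsub>KS\<^esub> b') 1 - Poly_Mapping.single (a, b) 1 - Poly_Mapping.single (a, b') 1)) 0"
      if "b \<in> carrier KS" "b' \<in> carrier KS" for a b b'
      using cong_mult [OF cong_refl rep_add [OF that], of "mconst a"]
      unfolding cong_def \<theta>_diff \<theta>_single mconst.hom_one by (simp add: algebra_simps)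
    have 3: "cong (\<theta> (Poly_Mapping.single (mconst c * a, b) 1 - Poly_Mapping.single (a, b) c)) 0" for a b c
      by (simp add: \<theta>_diff \<theta>_single mconst.hom_one)
    have 4: "cong (\<theta> (Poly_Mapping.single (a, c \<odot>\<^bsub>KS\<^esub> b) 1 - Poly_Mapping.single (a, b) c)) 0"
      if "b \<in> carrier KS" for a b c
      using cong_mult [OF cong_refl rep_smult [OF that], of "mconst a" c]
      by (simp add: \<theta>_diff \<theta>_single mconst.hom_one mconst.hom_mult cong_def algebra_simps)
    have "cong (\<theta> x) 0" if "x \<in> bilinear_rels KB KS" for x
      using that unfolding bilinear_rels_def KB_simps
      by (elim UnE CollectE exE conjE) (simp_all only: 1 2 3 4)
    then show "bilinear_rels KB KS \<subseteq> {x \<in> carrier F. cong (\<theta> x) 0}"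
      using bilinear_rels_closed by blast
  qed
  then show ?thesis using assms by blast
qed

text \<open>The graph of the homomorphism \<open>b \<otimes> g \<mapsto> b g\<close> from the tensor product to \<open>k[B][X] / (det X - 1)\<close>.\<close>

definition good :: "'k tens \<Rightarrow> (int \<times> int, (int \<times> int, 'k) mpol) mpol \<Rightarrow> bool" where
  "good X f \<longleftrightarrow> (\<exists>x\<in>carrier F. X = TI +>\<^bsub>F\<^esub> x \<and> cong (\<theta> x) f)"

text \<open>The graph is single-valued: two formal representatives of a tensor differ by an element
  of the ideal, which \<open>\<theta>\<close> sends to 0 modulo det X - 1.\<close>

lemma good_cong: "good X f \<Longrightarrow> good X g \<Longrightarrow> cong f g"
proof -
  assume "good X f" "good X g"
  then obtain x y where xy: "x \<in> carrier F" "y \<in> carrier F" "TI +>\<^bsub>F\<^esub> x = TI +>\<^bsub>F\<^esub> y"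
    "cong (\<theta> x) f" "cong (\<theta> y) g"
    unfolding good_def by metis
  then have "x - y \<in> TI" by (simp add: TI.coset_eq_iff free_pair_minus)
  then have "cong (\<theta> x) (\<theta> y)"
    using \<theta>_tensor_ideal [of "x - y"] by (simp add: \<theta>_diff cong_def)
  then show ?thesis using xy cong_sym cong_trans by metis
qed

lemma good_add: "good X f \<Longrightarrow> good Y g \<Longrightarrow> good (X \<oplus>\<^bsub>T\<^esub> Y) (f + g)"
  unfolding good_def
proof (elim bexE conjE)
  fix x y assume "x \<in> carrier F" "X = TI +>\<^bsub>F\<^esub> x" "cong (\<theta> x) f" "y \<in> carrier F" "Y = TI +>\<^bsub>F\<^esub> y" "cong (\<theta> y) g"
  then show "\<exists>z\<in>carrier F. X \<oplus>\<^bsub>T\<^esub> Y = TI +>\<^bsub>F\<^esub> z \<and> cong (\<theta> z) (f + g)"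
    using F.add.m_closed [of x y] by (intro bexI [of _ "x + y"]) (auto simp: coset_add \<theta>_add cong_add free_pair_simps(5))
qed

lemma good_mult: "good X f \<Longrightarrow> good Y g \<Longrightarrow> good (X \<otimes>\<^bsub>T\<^esub> Y) (f * g)"
  unfolding good_def
proof (elim bexE conjE)
  fix x y assume "x \<in> carrier F" "X = TI +>\<^bsub>F\<^esub> x" "cong (\<theta> x) f" "y \<in> carrier F" "Y = TI +>\<^bsub>F\<^esub> y" "cong (\<theta> y) g"
  then show "\<exists>z\<in>carrier F. X \<otimes>\<^bsub>T\<^esub> Y = TI +>\<^bsub>F\<^esub> z \<and> cong (\<theta> z) (f * g)"
    using cong_trans [OF \<theta>_mult cong_mult] by (intro bexI [of _ "x \<otimes>\<^bsub>F\<^esub> y"]) (auto simp: coset_mult)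
qed

lemma good_pt:
  assumes "a \<in> carrier KB" "b \<in> carrier KS" "cong (rep b) g"
  shows "good (pt a b) (mconst a * g)"
  unfolding good_def pure_tensor_def using assms
  by (intro bexI [of _ "Poly_Mapping.single (a, b) 1"] conjI refl single_closed)
    (auto simp: \<theta>_single mconst.hom_one intro: cong_mult)

lemma good_pt_one: "p \<in> carrier KB \<Longrightarrow> good (pt p \<one>\<^bsub>KS\<^esub>) (mconst p)"
  using good_pt [of p "\<one>\<^bsub>KS\<^esub>" 1] rep_one by simp

lemma good_finsum:
  assumes "finite K" "\<And>k. k \<in> K \<Longrightarrow> good (X k) (f k)"
  shows "good (\<Oplus>\<^bsub>T\<^esub>k\<in>K. X k) (sum f K)"
  using assms
proof (induction K rule: finite_induct)
  case empty
  have "\<zero>\<^bsub>T\<^esub> = pt 0 \<one>\<^bsub>KS\<^esub>"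
    using pt_left_mconst [of 0] by (simp add: mconst.hom_zero)
  then show ?case
    using good_pt_one [of 0] by (simp add: mconst.hom_zero)
next
  case (insert k K)
  have "X j \<in> carrier T" if "j \<in> insert k K" for j
    using insert.prems [OF that] by (auto simp: good_def carrier_tensor)
  then show ?case
    using insert by (simp add: Pi_iff good_add)
qed

text \<open>The coaction corresponds to p(B X): on b_ij both give the sum of b_ik x_kj, and the
  graph respects sums and products.\<close>

lemma good_rho:
  assumes "p \<in> carrier (poly_alg V1)"
  shows "good (rho m n p) (peval (\<lambda>c. mconst (mconst c)) (rsub {- int m..int n - 1} {- int m..-1} (\<lambda>i k. mvar (i, k))) p)"
proof -
  let ?R = "rsub {- int m..int n - 1} {- int m..-1} (\<lambda>i k. mvar (i, k) :: (int \<times> int, 'k) mpol)"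
  interpret mc: comm_ring_hom "\<lambda>c::'k. mconst (mconst c :: (int \<times> int, 'k) mpol) :: (int \<times> int, (int \<times> int, 'k) mpol) mpol"
    by (rule comm_ring_hom_comp [OF comm_ring_hom_mconst comm_ring_hom_mconst])
  show ?thesis
    using assms
  proof (induction p rule: mpol_mvar_induct)
    case (mconst c)
    show ?case
      using good_pt_one [of "mconst c"] by (simp add: rho_mconst pt_left_mconst)
  next
    case (mvar v q)
    then obtain i j where v: "v = (i, j)" "i \<in> {- int m..int n - 1}" "j \<in> {- int m..-1}" by auto
    have "good (pt (mvar (i, k)) (cs (mvar (k, j)))) (mconst (mvar (i, k)) * mvar (k, j))" if "k \<in> {- int m..-1}" for k
    proof -
      have "(i, k) \<in> V1" "(k, j) \<in> V2" using v that by auto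
      then show ?thesis
        using rep_cs [of "mvar (k, j)"]
        by (intro good_pt cs_mvar_closed) (simp_all add: KM_closed poly_alg_closed(7))
    qed
    then have "good (\<Oplus>\<^bsub>T\<^esub>k\<in>{- int m..-1}. pt (mvar (i, k)) (cs (mvar (k, j))))
        (\<Sum>k\<in>{- int m..-1}. mconst (mvar (i, k)) * mvar (k, j))"
      by (rule good_finsum [OF finite_atLeastAtMost_int])
    then have "good (rv v) (?R v)"
      using v by (simp add: rv_def rsub_def SL_coord_eq)
    then have "good (rho m n (mvar v) \<otimes>\<^bsub>T\<^esub> rho m n q) (?R v * peval (\<lambda>c. mconst (mconst c)) ?R q)"
      using mvar by (simp add: rho_mvar good_mult)
    then show ?case
      using ring_hom_mult [OF rho_hom, of "mvar v" q] mvar by (simp add: mc.peval_mult poly_alg_closed(7))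
  next
    case (add p q)
    then show ?case
      using ring_hom_add [OF rho_hom, of p q] by (simp add: mc.peval_add good_add)
  qed
qed

lemma kdelta_subalgebra:
  "subalgebra_of_minors m {- int m..int n - 1} (carrier (kdelta m n) :: (int \<times> int, 'k) mpol set)"
proof -
  have "c \<odot>\<^bsub>KB\<^esub> \<one>\<^bsub>KB\<^esub> = mconst c" for c by simp
  then show ?thesis
    unfolding subalgebra_of_minors_def kdelta_def gen_subalg_def
    using generate_ring.eng_add [where R = KB] generate_ring.eng_mult [where R = KB]
    by (auto intro!: generate_ring.incl)
qed

end

text \<open>If \<open>p\<close> is coinvariant, one and the same tensor lies over p(B X) and over p,
  so these are congruent modulo det X - 1; this is the divisibility that the Reynolds operator
  needs.\<close>

lemma kdelta_iff_coinvariant: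
  fixes p :: "(int \<times> int, 'k::field_char_0) mpol"
  assumes "m \<ge> 1"
  shows "p \<in> carrier (kdelta m n) \<longleftrightarrow>
    p \<in> carrier (kb m n) \<and> rho m n p = pure_tensor (kb m n) (kSL m) p \<one>\<^bsub>kSL m\<^esub>"
proof -
  interpret coaction m n "TYPE('k)" .
  show ?thesis
  proof
    assume "p \<in> carrier (kdelta m n)"
    then show "p \<in> carrier (kb m n) \<and> rho m n p = pt p \<one>\<^bsub>kSL m\<^esub>"
      using coinvariant_kdelta by simp
  next
    assume p: "p \<in> carrier (kb m n) \<and> rho m n p = pt p \<one>\<^bsub>kSL m\<^esub>"
    then have "cong (peval (\<lambda>c. mconst (mconst c)) (rsub {- int m..int n - 1} {- int m..-1} (\<lambda>i k. mvar (i, k))) p) (mconst p)"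
      using good_rho [of p] good_pt_one [of p] good_cong by simp
    then show "p \<in> carrier (kdelta m n)"
      unfolding cong_def by (intro invariant_in_minors [OF kdelta_subalgebra _ assms]) simp_all
  qed
qed

section \<open>The theorem in the limit\<close>

text \<open>Limits, coaction and coinvariance are componentwise, so the finite levels decide
  membership. Equality of records also requires equal operations; those of \<open>kdelta\<close> are
  inherited from \<open>kb\<close>.\<close>

theorem mainTheorem8:
  shows "(coinvariants ::
      ('k::{alg_closed_field, field_char_0}, nat \<times> nat \<Rightarrow> (int \<times> int, 'k) mpol) module)
    = kdelta_inf"
proof -
  have ops: "monoid.mult (kdelta m n) = monoid.mult (kb m n :: ('k, (int \<times> int, 'k) mpol) module)"
    "one (kdelta m n) = one (kb m n :: ('k, (int \<times> int, 'k) mpol) module)"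
    "zero (kdelta m n) = zero (kb m n :: ('k, (int \<times> int, 'k) mpol) module)"
    "add (kdelta m n) = add (kb m n :: ('k, (int \<times> int, 'k) mpol) module)"
    "module.smult (kdelta m n) = module.smult (kb m n :: ('k, (int \<times> int, 'k) mpol) module)" for m n
    by (simp_all add: kdelta_def gen_subalg_def)
  have "x \<in> carrier kM_inf \<and> rho_inf x = tensor_one_inf x \<longleftrightarrow> x \<in> carrier kdelta_inf"
    for x :: "nat \<times> nat \<Rightarrow> (int \<times> int, 'k) mpol"
  proof -
    \<comment> \<open>Both families take the default value outside \<open>pos_pairs\<close>, so
      their equality is equality at every level.\<close>
    have rho_iff: "rho_inf x = tensor_one_inf x \<longleftrightarrow> (\<forall>m n. (m, n) \<in> pos_pairs \<longrightarrow>
        rho m n (x (m, n)) = pure_tensor (kb m n) (kSL m) (x (m, n)) \<one>\<^bsub>kSL m\<^esub>)"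
      by (auto simp: rho_inf_def tensor_one_inf_def fun_eq_iff restrict_def)
    have PiE_iff': "x \<in> (\<Pi>\<^sub>E (m, n)\<in>pos_pairs. C m n) \<longleftrightarrow>
        x \<in> extensional pos_pairs \<and> (\<forall>m n. (m, n) \<in> pos_pairs \<longrightarrow> x (m, n) \<in> C m n)" for C
      by (auto simp: PiE_iff)
    have "x (m, n) \<in> carrier (kdelta m n) \<longleftrightarrow> x (m, n) \<in> carrier (kb m n) \<and>
        rho m n (x (m, n)) = pure_tensor (kb m n) (kSL m) (x (m, n)) \<one>\<^bsub>kSL m\<^esub>" if "(m, n) \<in> pos_pairs" for m n
      using that by (intro kdelta_iff_coinvariant) (simp add: pos_pairs_def)
    then have carrier: "x \<in> (\<Pi>\<^sub>E (m, n)\<in>pos_pairs. carrier (kb m n)) \<and> rho_inf x = tensor_one_inf x \<longleftrightarrow>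
        x \<in> (\<Pi>\<^sub>E (m, n)\<in>pos_pairs. carrier (kdelta m n))"
      unfolding rho_iff PiE_iff' by blast
    \<comment> \<open>\<open>e_map\<close> has a default value outside the subalgebra of minors, but
      the components of \<open>x\<close> lie inside it, so the two compatibility conditions
      agree.\<close>
    have "e_map m' n' m n (x (m', n')) = E_map m' n' m n (x (m', n'))"
      if "x \<in> (\<Pi>\<^sub>E (m, n)\<in>pos_pairs. carrier (kdelta m n))" "1 \<le> m \<and> m \<le> m' \<and> 1 \<le> n \<and> n \<le> n'" for m' n' m n
      using PiE_mem [OF that(1), of "(m', n')"] that(2) by (simp add: pos_pairs_def e_map_def)
    then have "(\<forall>m' n' m n. 1 \<le> m \<and> m \<le> m' \<and> 1 \<le> n \<and> n \<le> n' \<longrightarrow> e_map m' n' m n (x (m', n')) = x (m, n)) \<longleftrightarrow>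
        (\<forall>m' n' m n. 1 \<le> m \<and> m \<le> m' \<and> 1 \<le> n \<and> n \<le> n' \<longrightarrow> E_map m' n' m n (x (m', n')) = x (m, n))"
      if "x \<in> (\<Pi>\<^sub>E (m, n)\<in>pos_pairs. carrier (kdelta m n))"
      using that by (intro iff_allI imp_cong refl) simp
    with carrier show ?thesis
      unfolding kM_inf_def kdelta_inf_def proj_lim_def partial_object.simps mem_Collect_eq by blast
  qed
  then have "{x \<in> carrier kM_inf. rho_inf x = tensor_one_inf x} = (carrier kdelta_inf :: (nat \<times> nat \<Rightarrow> (int \<times> int, 'k) mpol) set)"
    by blast
  then show ?thesis
    by (simp add: coinvariants_def kM_inf_def kdelta_inf_def proj_lim_def ops)
qed

end
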